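(* Let $k$ be an algebraically closed field, let $(e_i)_{1\le i\le 6}$ be the canonical basis of $k^6$, and let $\omega$ be the symplectic form on $k^6$ with $\omega(e_i,e_j)=\delta_{7,i+j}$ for all $i<j$. Let $G=\mathrm{Sp}_6$ be the group of linear automorphisms of $k^6$ preserving $\omega$, let $P_1=P_2$ be the stabiliser in $G$ of the $3$-dimensional isotropic subspace $\langle e_1,e_2,e_3\rangle$, and let $X=G/P_1\times G/P_2$, identified with the set of pairs of $3$-dimensional (maximal) $\omega$-isotropic subspaces of $k^6$. Let $B\subset G$ be the Borel subgroup stabilising the complete flag $$\langle e_1\rangle\subset\langle e_1,e_2\rangle\subset\langle e_1,e_2,e_3\rangle\subset\langle e_1,e_2,e_3,e_4\rangle\subset\langle e_1,e_2,e_3,e_4,e_5\rangle\subset k^6 .$$ Then the closure in $X$ of the $B$-orbit $\mathcal{O}$ of the element $$x=(\langle e_3,\,e_1+e_5,\,e_2+e_6\rangle,\ \langle e_4,e_5,e_6\rangle)$$ is not normal.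
   Context: $\langle\cdots\rangle$ denotes linear span, $\delta$ is the Kronecker symbol, and $B$ acts on $X$ diagonally. *)

theory Defs
  imports
    "HOL-Algebra.QuotRing"
    "HOL-Algebra.Polynomials"
    "HOL-Computational_Algebra.Polynomial"
    "HOL-Analysis.Analysis"
begin

section \<open>Integrally closed domains\<close>

definition frac_rel :: "('a, 'b) ring_scheme \<Rightarrow> (('a \<times> 'a) \<times> ('a \<times> 'a)) set" where
  "frac_rel R =
    {((a, b), (c, d)) | a b c d. a \<in> carrier R \<and> c \<in> carrier R \<and>
       b \<in> carrier R - {\<zero>\<^bsub>R\<^esub>} \<and> d \<in> carrier R - {\<zero>\<^bsub>R\<^esub>} \<and> a \<otimes>\<^bsub>R\<^esub> d = c \<otimes>\<^bsub>R\<^esub> b}"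

text \<open>The class of the pair \<open>(a, b)\<close> is the fraction \<open>a / b\<close>.\<close>

definition frac :: "('a, 'b) ring_scheme \<Rightarrow> 'a \<Rightarrow> 'a \<Rightarrow> ('a \<times> 'a) set" where
  "frac R a b = frac_rel R `` {(a, b)}"

definition fraction_field :: "('a, 'b) ring_scheme \<Rightarrow> ('a \<times> 'a) set ring" where
  "fraction_field R =
    \<lparr>carrier = (carrier R \<times> (carrier R - {\<zero>\<^bsub>R\<^esub>})) // frac_rel R,
     mult = (\<lambda>x y. \<Union>{frac R (a \<otimes>\<^bsub>R\<^esub> c) (b \<otimes>\<^bsub>R\<^esub> d) | a b c d. (a, b) \<in> x \<and> (c, d) \<in> y}),
     one = frac R \<one>\<^bsub>R\<^esub> \<one>\<^bsub>R\<^esub>,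
     zero = frac R \<zero>\<^bsub>R\<^esub> \<one>\<^bsub>R\<^esub>,
     add = (\<lambda>x y. \<Union>{frac R ((a \<otimes>\<^bsub>R\<^esub> d) \<oplus>\<^bsub>R\<^esub> (c \<otimes>\<^bsub>R\<^esub> b)) (b \<otimes>\<^bsub>R\<^esub> d) | a b c d.
              (a, b) \<in> x \<and> (c, d) \<in> y})\<rparr>"

definition integral_over :: "('a, 'b) ring_scheme \<Rightarrow> 'a set \<Rightarrow> 'a \<Rightarrow> bool" where
  "integral_over K A x \<longleftrightarrow>
    (\<exists>p. polynomial\<^bsub>K\<^esub> A p \<and> p \<noteq> [] \<and> hd p = \<one>\<^bsub>K\<^esub> \<and> ring.eval K p x = \<zero>\<^bsub>K\<^esub>)"

definition integrally_closed_domain :: "('a, 'b) ring_scheme \<Rightarrow> bool" where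
  "integrally_closed_domain R \<longleftrightarrow> domain R \<and>
    (let K = fraction_field R; A = (\<lambda>a. frac R a \<one>\<^bsub>R\<^esub>) ` carrier R
     in \<forall>x\<in>carrier K. integral_over K A x \<longrightarrow> x \<in> A)"

lemma frac_rel_equiv:
  fixes R (structure)
  assumes "domain R"
  shows "equiv (carrier R \<times> (carrier R - {\<zero>\<^bsub>R\<^esub>})) (frac_rel R)"
proof -
  interpret domain R by fact
  show ?thesis
  proof (rule equivI)
    show "frac_rel R \<subseteq> (carrier R \<times> (carrier R - {\<zero>})) \<times> carrier R \<times> (carrier R - {\<zero>})"
      by (auto simp: frac_rel_def)
    show "refl_on (carrier R \<times> (carrier R - {\<zero>})) (frac_rel R)"
      by (auto simp: refl_on_def frac_rel_def)
    show "sym (frac_rel R)"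
      by (auto simp: sym_def frac_rel_def)
    show "trans (frac_rel R)"
    proof (rule transI)
      fix x y z
      assume "(x, y) \<in> frac_rel R" "(y, z) \<in> frac_rel R"
      then obtain a b c d e f where xyz: "x = (a, b)" "y = (c, d)" "z = (e, f)"
        and car: "a \<in> carrier R" "c \<in> carrier R" "e \<in> carrier R"
          "b \<in> carrier R" "d \<in> carrier R" "f \<in> carrier R"
        and nz: "b \<noteq> \<zero>" "d \<noteq> \<zero>" "f \<noteq> \<zero>"
        and 1: "a \<otimes> d = c \<otimes> b" and 2: "c \<otimes> f = e \<otimes> d"
        by (auto simp: frac_rel_def)
      have "d \<otimes> (a \<otimes> f) = (a \<otimes> d) \<otimes> f" using car by (simp add: m_ac)
      also have "\<dots> = (c \<otimes> f) \<otimes> b" using car 1 by (simp add: m_ac)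
      also have "\<dots> = d \<otimes> (e \<otimes> b)" using car 2 by (simp add: m_ac)
      finally have "a \<otimes> f = e \<otimes> b"
        using car nz m_lcancel by (meson m_closed)
      then show "(x, z) \<in> frac_rel R"
        using xyz car nz by (auto simp: frac_rel_def)
    qed
  qed
qed

context
  fixes R (structure)
  assumes dom: "domain R"
begin
interpretation domain R by (rule dom)
abbreviation (input) "frac_pairs \<equiv> carrier R \<times> (carrier R - {\<zero>})"

lemma frac_rel_iff: "((a,b), (c,d)) \<in> frac_rel R \<longleftrightarrow> (a,b) \<in> frac_pairs \<and> (c,d) \<in> frac_pairs \<and> a \<otimes> d = c \<otimes> b"
  unfolding frac_rel_def by auto

lemma frac_eq: "\<lbrakk>(a,b) \<in> frac_pairs; (c,d) \<in> frac_pairs\<rbrakk> \<Longrightarrow> frac R a b = frac R c d \<longleftrightarrow> a \<otimes> d = c \<otimes> b"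
  unfolding frac_def by (subst eq_equiv_class_iff[OF frac_rel_equiv[OF dom]]) (simp_all add: frac_rel_iff)

lemma mem_frac: "(a,b) \<in> frac_pairs \<Longrightarrow> (c,d) \<in> frac R a b \<longleftrightarrow> (c,d) \<in> frac_pairs \<and> frac R c d = frac R a b"
  using frac_eq[of a b c d] by (auto simp: frac_rel_iff frac_def)

lemma carrier_fraction_field: "x \<in> carrier (fraction_field R) \<longleftrightarrow> (\<exists>a b. (a,b) \<in> frac_pairs \<and> x = frac R a b)"
  by (auto simp: fraction_field_def quotient_def frac_def)

lemma Union_eq_const: "A \<noteq> {} \<Longrightarrow> (\<And>x. x \<in> A \<Longrightarrow> x = c) \<Longrightarrow> \<Union>A = c"
  by (metis (no_types) ccpo_Sup_singleton is_singletonI' is_singleton_the_elem singletonI)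

lemma mult_frac: assumes "(a,b) \<in> frac_pairs" "(c,d) \<in> frac_pairs"
  shows "frac R a b \<otimes>\<^bsub>fraction_field R\<^esub> frac R c d = frac R (a \<otimes> c) (b \<otimes> d)"
  unfolding fraction_field_def monoid.simps
proof (rule Union_eq_const, goal_cases)
  case 1 show ?case using assms mem_frac[OF assms(1), of a b] mem_frac[OF assms(2), of c d] by blast
next
  case (2 x)
  then obtain a' b' c' d' where x: "x = frac R (a' \<otimes> c') (b' \<otimes> d')" and
    m: "(a',b') \<in> frac_pairs" "a' \<otimes> b = a \<otimes> b'" "(c',d') \<in> frac_pairs" "c' \<otimes> d = c \<otimes> d'"
    using assms by (auto simp: mem_frac frac_eq)
  have "(a' \<otimes> c') \<otimes> (b \<otimes> d) = (a' \<otimes> b) \<otimes> (c' \<otimes> d)" using m(1,3) assms by (simp add: m_ac)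
  also have "\<dots> = (a \<otimes> c) \<otimes> (b' \<otimes> d')" unfolding m(2,4) using m(1,3) assms by (simp add: m_ac)
  finally show ?case unfolding x using m(1,3) assms by (subst frac_eq) (auto simp: integral_iff)
qed

lemma add_frac: assumes "(a,b) \<in> frac_pairs" "(c,d) \<in> frac_pairs"
  shows "frac R a b \<oplus>\<^bsub>fraction_field R\<^esub> frac R c d = frac R (a \<otimes> d \<oplus> c \<otimes> b) (b \<otimes> d)"
  unfolding fraction_field_def ring.simps
proof (rule Union_eq_const, goal_cases)
  case 1 show ?case using assms mem_frac[OF assms(1), of a b] mem_frac[OF assms(2), of c d] by blast
next
  case (2 x)
  then obtain a' b' c' d' where x: "x = frac R (a' \<otimes> d' \<oplus> c' \<otimes> b') (b' \<otimes> d')" and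
    m: "(a',b') \<in> frac_pairs" "a' \<otimes> b = a \<otimes> b'" "(c',d') \<in> frac_pairs" "c' \<otimes> d = c \<otimes> d'"
    using assms by (auto simp: mem_frac frac_eq)
  have "(a' \<otimes> d' \<oplus> c' \<otimes> b') \<otimes> (b \<otimes> d) = (a' \<otimes> b) \<otimes> (d \<otimes> d') \<oplus> (c' \<otimes> d) \<otimes> (b \<otimes> b')"
    using m(1,3) assms by (simp add: l_distr r_distr m_ac)
  also have "\<dots> = (a \<otimes> d \<oplus> c \<otimes> b) \<otimes> (b' \<otimes> d')" unfolding m(2,4) using m(1,3) assms by (simp add: l_distr r_distr m_ac)
  finally show ?case unfolding x using m(1,3) assms by (subst frac_eq) (auto simp: integral_iff)
qed

lemma field_fraction_field: "field (fraction_field R)"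
proof -
  let ?K = "fraction_field R"
  have o: "\<one>\<^bsub>?K\<^esub> = frac R \<one> \<one>" "\<zero>\<^bsub>?K\<^esub> = frac R \<zero> \<one>" by (simp_all add: fraction_field_def)
  have I: "frac R a b \<in> carrier ?K" if "(a,b) \<in> frac_pairs" for a b using that carrier_fraction_field by auto
  have E: "\<exists>a b. (a,b) \<in> frac_pairs \<and> x = frac R a b" if "x \<in> carrier ?K" for x using that carrier_fraction_field by auto
  have nz: "b \<otimes> d \<noteq> \<zero>" if "b \<in> carrier R" "d \<in> carrier R" "b \<noteq> \<zero>" "d \<noteq> \<zero>" for b d using that integral_iff by auto
  have cr: "cring ?K"
  proof (rule cringI)
    show "abelian_group ?K"
    proof (rule abelian_groupI, goal_cases)
      case (1 x y) with E[of x] E[of y] show ?case by (auto simp: add_frac nz intro!: I)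
    next case 2 show ?case by (auto simp: o intro!: I)
    next case (3 x y z) with E[of x] E[of y] E[of z] show ?case by (auto simp: add_frac nz l_distr r_distr m_ac a_ac)
    next case (4 x y) with E[of x] E[of y] show ?case by (auto simp: add_frac nz m_ac a_ac)
    next case (5 x) with E[of x] show ?case by (auto simp: add_frac o)
    next case (6 x)
      then obtain a b where x: "(a,b) \<in> frac_pairs" "x = frac R a b" using E[OF 6] by blast
      show ?case by (rule bexI[of _ "frac R (\<ominus> a) b"]) (use x in \<open>auto simp: add_frac o nz frac_eq l_minus l_neg intro!: I\<close>)
    qed
    show "comm_monoid ?K"
    proof (rule comm_monoidI, goal_cases)
      case (1 x y) with E[of x] E[of y] show ?case by (auto simp: mult_frac nz intro!: I)
    next case 2 show ?case by (auto simp: o intro!: I)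
    next case (3 x y z) with E[of x] E[of y] E[of z] show ?case by (auto simp: mult_frac nz m_ac)
    next case (4 x) with E[of x] show ?case by (auto simp: mult_frac o)
    next case (5 x y) with E[of x] E[of y] show ?case by (auto simp: mult_frac nz m_ac a_ac)
    qed
    fix x y z assume "x \<in> carrier ?K" "y \<in> carrier ?K" "z \<in> carrier ?K"
    then obtain a b c d p q where *: "(a,b) \<in> frac_pairs" "(c,d) \<in> frac_pairs" "(p,q) \<in> frac_pairs" "x = frac R a b" "y = frac R c d" "z = frac R p q"
      using E by meson
    have "((a \<otimes> d \<oplus> c \<otimes> b) \<otimes> p) \<otimes> ((b \<otimes> q) \<otimes> (d \<otimes> q)) = ((a \<otimes> p) \<otimes> (d \<otimes> q) \<oplus> (c \<otimes> p) \<otimes> (b \<otimes> q)) \<otimes> ((b \<otimes> d) \<otimes> q)"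
      using * by (simp add: l_distr r_distr m_ac)
    with * show "(x \<oplus>\<^bsub>?K\<^esub> y) \<otimes>\<^bsub>?K\<^esub> z = x \<otimes>\<^bsub>?K\<^esub> z \<oplus>\<^bsub>?K\<^esub> y \<otimes>\<^bsub>?K\<^esub> z"
      by (simp add: add_frac mult_frac nz frac_eq)
  qed
  interpret K: cring ?K by (rule cr)
  show ?thesis
  proof (rule K.cring_fieldI2)
    show "\<zero>\<^bsub>?K\<^esub> \<noteq> \<one>\<^bsub>?K\<^esub>" by (simp add: o frac_eq)
    fix x assume x: "x \<in> carrier ?K" "x \<noteq> \<zero>\<^bsub>?K\<^esub>"
    obtain a b where *: "(a,b) \<in> frac_pairs" "x = frac R a b" using E[OF x(1)] by blast
    have a: "a \<noteq> \<zero>"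
    proof
      assume "a = \<zero>"
      then have "frac R a b = frac R \<zero> \<one>" using * by (subst frac_eq) auto
      then show False using x(2) * by (simp add: o)
    qed
    have ba: "(b, a) \<in> frac_pairs" using * a by simp
    have "x \<otimes>\<^bsub>?K\<^esub> frac R b a = frac R (a \<otimes> b) (b \<otimes> a)" unfolding *(2) by (rule mult_frac[OF *(1) ba])
    also have "\<dots> = frac R \<one> \<one>" using * a ba by (subst frac_eq) (simp_all add: nz m_comm)
    finally show "\<exists>y\<in>carrier ?K. x \<otimes>\<^bsub>?K\<^esub> y = \<one>\<^bsub>?K\<^esub>"
      unfolding o using I[OF ba] by blast
  qed
qed
end


section \<open>Zariski topology and regular functions\<close>

text \<open>
  Varieties are treated as spaces with functions: a topology \<open>T\<close> on a set of points together with a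
  predicate \<open>reg U f\<close> saying that \<open>f\<close> is a regular \<open>k\<close>-valued function on the open set \<open>U\<close>; the
  values of \<open>f\<close> outside \<open>U\<close> are irrelevant.
\<close>

text \<open>Polynomials in a given set \<open>C\<close> of coordinate functions.\<close>

inductive_set polynomial_functions :: "('a \<Rightarrow> 'k::comm_ring_1) set \<Rightarrow> ('a \<Rightarrow> 'k) set"
  for C :: "('a \<Rightarrow> 'k) set" where
  const: "(\<lambda>_. c) \<in> polynomial_functions C"
| coord: "f \<in> C \<Longrightarrow> f \<in> polynomial_functions C"
| add: "\<lbrakk>f \<in> polynomial_functions C; g \<in> polynomial_functions C\<rbrakk>
    \<Longrightarrow> (\<lambda>x. f x + g x) \<in> polynomial_functions C"
| mult: "\<lbrakk>f \<in> polynomial_functions C; g \<in> polynomial_functions C\<rbrakk>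
    \<Longrightarrow> (\<lambda>x. f x * g x) \<in> polynomial_functions C"

definition zero_locus :: "('a \<Rightarrow> 'k::zero) set \<Rightarrow> 'a set" where
  "zero_locus S = {x. \<forall>p\<in>S. p x = 0}"

definition zariski_topology :: "('a \<Rightarrow> 'k::idom) set \<Rightarrow> 'a topology" where
  "zariski_topology C = topology (\<lambda>U. \<exists>S \<subseteq> polynomial_functions C. U = - zero_locus S)"

lemma openin_zariski_topology:
  "openin (zariski_topology C) U \<longleftrightarrow> (\<exists>S \<subseteq> polynomial_functions C. U = - zero_locus S)"
proof -
  let ?P = "polynomial_functions C"
  let ?L = "\<lambda>U. \<exists>S \<subseteq> ?P. U = - zero_locus S"
  have "istopology ?L"
    unfolding istopology_def
  proof (intro conjI allI impI)
    fix U V assume "?L U" "?L V"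
    then obtain S T where S: "S \<subseteq> ?P" "U = - zero_locus S" and T: "T \<subseteq> ?P" "V = - zero_locus T"
      by blast
    let ?W = "(\<lambda>(p, q) x. p x * q x) ` (S \<times> T)"
    have "?W \<subseteq> ?P" using S T by (auto intro: polynomial_functions.mult)
    moreover have "U \<inter> V = - zero_locus ?W"
    proof (rule Set.set_eqI)
      fix x
      have "x \<in> - zero_locus ?W \<longleftrightarrow> (\<exists>p\<in>S. \<exists>q\<in>T. p x * q x \<noteq> 0)"
        by (simp add: zero_locus_def)
      also have "\<dots> \<longleftrightarrow> x \<in> U \<inter> V"
        unfolding S T zero_locus_def by auto
      finally show "x \<in> U \<inter> V \<longleftrightarrow> x \<in> - zero_locus ?W" ..
    qed
    ultimately show "?L (U \<inter> V)" by blast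
  next
    fix \<U> assume "\<forall>U\<in>\<U>. ?L U"
    then obtain S where S: "\<And>U. U \<in> \<U> \<Longrightarrow> S U \<subseteq> ?P \<and> U = - zero_locus (S U)" by metis
    have "\<Union>(S ` \<U>) \<subseteq> ?P" using S by blast
    moreover have "\<Union>\<U> = - zero_locus (\<Union>(S ` \<U>))"
      using S unfolding zero_locus_def by blast
    ultimately show "?L (\<Union>\<U>)" by blast
  qed
  then show ?thesis by (simp add: zariski_topology_def)
qed

definition affine_regular ::
    "('a \<Rightarrow> 'k::field) set \<Rightarrow> 'a set \<Rightarrow> 'a set \<Rightarrow> ('a \<Rightarrow> 'k) \<Rightarrow> bool" where
  "affine_regular C V U f \<longleftrightarrow>
     openin (subtopology (zariski_topology C) V) U \<and>
     (\<forall>x\<in>U. \<exists>N a b. openin (subtopology (zariski_topology C) V) N \<and> x \<in> N \<and> N \<subseteq> U \<and>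
        a \<in> polynomial_functions C \<and> b \<in> polynomial_functions C \<and>
        (\<forall>z\<in>N. b z \<noteq> 0 \<and> f z = a z / b z))"

text \<open>
  The reduced structure induced on a (locally) closed subset \<open>Y\<close>: the functions on \<open>Y\<close> that are
  locally restrictions of regular functions of the ambient space.
\<close>

definition induced_regular ::
    "'a topology \<Rightarrow> ('a set \<Rightarrow> ('a \<Rightarrow> 'k) \<Rightarrow> bool) \<Rightarrow> 'a set \<Rightarrow> 'a set \<Rightarrow> ('a \<Rightarrow> 'k) \<Rightarrow> bool" where
  "induced_regular T reg Y U f \<longleftrightarrow>
     openin (subtopology T Y) U \<and>
     (\<forall>y\<in>U. \<exists>N F. openin T N \<and> y \<in> N \<and> reg N F \<and> (\<forall>x\<in>N \<inter> U. f x = F x))"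

definition functions_near ::
    "'a topology \<Rightarrow> ('a set \<Rightarrow> ('a \<Rightarrow> 'k::field) \<Rightarrow> bool) \<Rightarrow> 'a \<Rightarrow> ('a \<Rightarrow> 'k) ring" where
  "functions_near T reg y =
    \<lparr>carrier = {f. \<exists>U. openin T U \<and> y \<in> U \<and> reg U f},
     mult = (\<lambda>f g x. f x * g x), one = (\<lambda>_. 1), zero = (\<lambda>_. 0), add = (\<lambda>f g x. f x + g x)\<rparr>"

definition vanishing_near ::
    "'a topology \<Rightarrow> ('a set \<Rightarrow> ('a \<Rightarrow> 'k::field) \<Rightarrow> bool) \<Rightarrow> 'a \<Rightarrow> ('a \<Rightarrow> 'k) set" where
  "vanishing_near T reg y =
    {f \<in> carrier (functions_near T reg y). \<exists>U. openin T U \<and> y \<in> U \<and> (\<forall>x\<in>U. f x = 0)}"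

text \<open>
  The ring of germs at \<open>y\<close>: two functions regular near \<open>y\<close> have the same germ iff their difference
  vanishes in a neighbourhood of \<open>y\<close>.
\<close>

definition local_ring ::
    "'a topology \<Rightarrow> ('a set \<Rightarrow> ('a \<Rightarrow> 'k::field) \<Rightarrow> bool) \<Rightarrow> 'a \<Rightarrow> ('a \<Rightarrow> 'k) set ring" where
  "local_ring T reg y = functions_near T reg y Quot vanishing_near T reg y"

definition normal_variety ::
    "'a topology \<Rightarrow> ('a set \<Rightarrow> ('a \<Rightarrow> 'k::field) \<Rightarrow> bool) \<Rightarrow> bool" where
  "normal_variety T reg \<longleftrightarrow>
     (\<forall>y\<in>topspace T. integrally_closed_domain (local_ring T reg y))"


section \<open>The symplectic group and its flag varieties\<close>

text \<open>
  The index type \<open>6\<close> consists of the residues modulo 6, so \<open>of_nat\<close> is a bijection from \<open>{1..6}\<close>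
  onto it, with \<open>of_nat 6 = 0\<close>.
\<close>

definition e :: "nat \<Rightarrow> 'k::field ^ 6" where
  "e i = axis (of_nat i) 1"

definition \<omega> :: "'k::field ^ 6 \<Rightarrow> 'k ^ 6 \<Rightarrow> 'k" where
  "\<omega> x y = (\<Sum>i = 1..3. x $ of_nat i * y $ of_nat (7 - i) - x $ of_nat (7 - i) * y $ of_nat i)"

definition Sp6 :: "('k::field ^ 6 ^ 6) set" where
  "Sp6 = {g. invertible g \<and> (\<forall>x y. \<omega> (g *v x) (g *v y) = \<omega> x y)}"

definition act :: "'k::field ^ 6 ^ 6 \<Rightarrow> ('k ^ 6) set \<Rightarrow> ('k ^ 6) set" where
  "act g V = (*v) g ` V"

definition flag :: "nat \<Rightarrow> ('k::field ^ 6) set" where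
  "flag i = vec.span (e ` {1..i})"

definition Borel :: "('k::field ^ 6 ^ 6) set" where
  "Borel = {g \<in> Sp6. \<forall>i\<in>{1..6}. act g (flag i) = flag i}"

definition P_stab :: "('k::field ^ 6 ^ 6) set" where
  "P_stab = {g \<in> Sp6. act g (vec.span {e 1, e 2, e 3}) = vec.span {e 1, e 2, e 3}}"

definition lagrangian :: "('k::field ^ 6) set \<Rightarrow> bool" where
  "lagrangian V \<longleftrightarrow> vec.subspace V \<and> vec.dim V = 3 \<and> (\<forall>x\<in>V. \<forall>y\<in>V. \<omega> x y = 0)"

definition X_space :: "(('k::field ^ 6) set \<times> ('k ^ 6) set) set" where
  "X_space = {(V, W). lagrangian V \<and> lagrangian W}"

text \<open>
  The structure of variety on \<open>X = G/P\<^sub>1 \<times> G/P\<^sub>2 = (G \<times> G)/(P\<^sub>1 \<times> P\<^sub>2)\<close> is that of the quotient of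
  the affine variety \<open>G \<times> G\<close> by the map below, whose fibres are the cosets of \<open>P\<^sub>1 \<times> P\<^sub>2\<close>
  (see \<open>act_eq_iff_coset\<close>): a subset
  of \<open>X\<close> is open iff its preimage is, and a function is regular iff its pullback is.
\<close>

definition orbit_map :: "('k::field ^ 6 ^ 6) \<times> ('k ^ 6 ^ 6) \<Rightarrow> ('k ^ 6) set \<times> ('k ^ 6) set" where
  "orbit_map = (\<lambda>(g, h). (act g (vec.span {e 1, e 2, e 3}), act h (vec.span {e 1, e 2, e 3})))"

definition entries :: "(('k::field ^ 6 ^ 6) \<times> ('k ^ 6 ^ 6) \<Rightarrow> 'k) set" where
  "entries = range (\<lambda>(i, j) z. fst z $ i $ j) \<union> range (\<lambda>(i, j) z. snd z $ i $ j)"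

definition X_topology :: "(('k::field ^ 6) set \<times> ('k ^ 6) set) topology" where
  "X_topology = topology (\<lambda>U. U \<subseteq> X_space \<and>
     openin (subtopology (zariski_topology entries) (Sp6 \<times> Sp6)) {z \<in> Sp6 \<times> Sp6. orbit_map z \<in> U})"

definition X_regular ::
    "(('k::field ^ 6) set \<times> ('k ^ 6) set) set \<Rightarrow> (('k ^ 6) set \<times> ('k ^ 6) set \<Rightarrow> 'k) \<Rightarrow> bool" where
  "X_regular U f \<longleftrightarrow> openin X_topology U \<and>
     affine_regular entries (Sp6 \<times> Sp6) {z \<in> Sp6 \<times> Sp6. orbit_map z \<in> U} (f \<circ> orbit_map)"

definition Borel_orbit ::
    "('k::field ^ 6) set \<times> ('k ^ 6) set \<Rightarrow> (('k ^ 6) set \<times> ('k ^ 6) set) set" where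
  "Borel_orbit x = {(act b (fst x), act b (snd x)) | b. b \<in> Borel}"

definition normal_in_X :: "(('k::field ^ 6) set \<times> ('k ^ 6) set) set \<Rightarrow> bool" where
  "normal_in_X Y \<longleftrightarrow> normal_variety (subtopology X_topology Y) (induced_regular X_topology X_regular Y)"

lemma \<omega>_expand:
  "\<omega> x y = (x $ 1 * y $ 6 - x $ 6 * y $ 1) + (x $ 2 * y $ 5 - x $ 5 * y $ 2) + (x $ 3 * y $ 4 - x $ 4 * y $ 3)"
proof -
  have *: "{1..3::nat} = {1, 2, 3}" by auto
  show ?thesis unfolding \<omega>_def * by simp
qed

lemma \<omega>_e:
  assumes "1 \<le> i" "i < j" "j \<le> 6"
  shows "\<omega> (e i) (e j :: 'k::field ^ 6) = (if i + j = 7 then 1 else 0)"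
proof -
  have "i = 1 \<or> i = 2 \<or> i = 3 \<or> i = 4 \<or> i = 5" "j = 2 \<or> j = 3 \<or> j = 4 \<or> j = 5 \<or> j = 6"
    using assms by linarith+
  then show ?thesis using assms(2)
    by (elim disjE; simp add: \<omega>_expand e_def axis_def)
qed

lemma \<omega>_self [simp]: "\<omega> x x = 0"
  by (simp add: \<omega>_def mult.commute)

lemma \<omega>_add:
  "\<omega> (x + y) z = \<omega> x z + \<omega> y z" "\<omega> z (x + y) = \<omega> z x + \<omega> z y"
  by (simp_all add: \<omega>_def algebra_simps sum.distrib sum_subtractf)

lemma \<omega>_scale: "\<omega> (c *s x) y = c * \<omega> x y" "\<omega> x (c *s y) = c * \<omega> x y"
  by (simp_all add: \<omega>_def algebra_simps sum_distrib_left)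

lemma act_act: "act g (act h V) = act (g ** h) V"
  by (simp add: act_def image_image matrix_vector_mul_assoc)

lemma act_eq_iff_coset:
  assumes "g \<in> Sp6" "h \<in> Sp6"
  shows "act g (vec.span {e 1, e 2, e 3}) = act h (vec.span {e 1, e 2, e 3})
    \<longleftrightarrow> (\<exists>p\<in>P_stab. g = h ** p)"
proof
  assume eq: "act g (vec.span {e 1, e 2, e 3}) = act h (vec.span {e 1, e 2, e 3})"
  obtain k where k: "h ** k = mat 1" "k ** h = mat 1"
    using assms(2) unfolding Sp6_def invertible_def by blast
  have inv: "invertible (k ** g)"
    using k assms(1) by (intro invertible_mult) (auto simp: Sp6_def invertible_def)
  have g: "g = h ** (k ** g)"
    by (simp add: matrix_mul_assoc k)
  have "\<omega> ((k ** g) *v x) ((k ** g) *v y) = \<omega> x y" for x y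
  proof -
    have "\<omega> ((k ** g) *v x) ((k ** g) *v y) = \<omega> (h *v ((k ** g) *v x)) (h *v ((k ** g) *v y))"
      using assms(2) by (simp add: Sp6_def)
    also have "\<dots> = \<omega> (g *v x) (g *v y)"
      by (simp add: matrix_vector_mul_assoc matrix_mul_assoc k)
    finally show ?thesis using assms(1) by (simp add: Sp6_def)
  qed
  moreover have "act (k ** g) (vec.span {e 1, e 2, e 3}) = vec.span {e 1, e 2, e 3}"
  proof -
    have "act (k ** g) (vec.span {e 1, e 2, e 3}) = act k (act h (vec.span {e 1, e 2, e 3}))"
      unfolding eq[symmetric] by (simp add: act_act)
    also have "\<dots> = vec.span {e 1, e 2, e 3}" unfolding act_act k by (simp add: act_def)
    finally show ?thesis .
  qed
  ultimately have "k ** g \<in> P_stab" using inv by (simp add: P_stab_def Sp6_def)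
  with g show "\<exists>p\<in>P_stab. g = h ** p" by blast
qed (auto simp: P_stab_def act_act[symmetric])

lemma openin_X_topology:
  fixes U :: "(('k::field ^ 6) set \<times> ('k ^ 6) set) set"
  shows "openin X_topology U \<longleftrightarrow> U \<subseteq> X_space \<and>
     openin (subtopology (zariski_topology entries) (Sp6 \<times> Sp6)) {z \<in> Sp6 \<times> Sp6. orbit_map z \<in> U}"
proof -
  let ?T = "subtopology (zariski_topology (entries :: (('k ^ 6 ^ 6) \<times> ('k ^ 6 ^ 6) \<Rightarrow> 'k) set)) (Sp6 \<times> Sp6)"
  let ?pre = "\<lambda>U :: (('k ^ 6) set \<times> ('k ^ 6) set) set. {z \<in> Sp6 \<times> Sp6. orbit_map z \<in> U}"
  have "istopology (\<lambda>U. U \<subseteq> X_space \<and> openin ?T (?pre U))"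
    unfolding istopology_def
  proof (rule conjI; intro allI impI)
    fix U V assume "U \<subseteq> X_space \<and> openin ?T (?pre U)" "V \<subseteq> X_space \<and> openin ?T (?pre V)"
    moreover from this have "openin ?T (?pre U \<inter> ?pre V)" by (blast intro: openin_Int)
    moreover have "?pre (U \<inter> V) = ?pre U \<inter> ?pre V" by blast
    ultimately show "U \<inter> V \<subseteq> X_space \<and> openin ?T (?pre (U \<inter> V))" by auto
  next
    fix \<U> assume *: "\<forall>U\<in>\<U>. U \<subseteq> X_space \<and> openin ?T (?pre U)"
    then have "openin ?T (\<Union>(?pre ` \<U>))" by (intro openin_Union) blast
    moreover have "?pre (\<Union>\<U>) = \<Union>(?pre ` \<U>)" by blast
    ultimately show "\<Union>\<U> \<subseteq> X_space \<and> openin ?T (?pre (\<Union>\<U>))" using * by auto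
  qed
  then show ?thesis by (simp add: X_topology_def)
qed

end

theory Submission
  imports Defs
begin

text \<open>
  Write a Lagrangian subspace transversal to \<open>\<langle>e\<^sub>2, e\<^sub>3, e\<^sub>6\<rangle>\<close> as a graph over \<open>\<langle>e\<^sub>1, e\<^sub>4, e\<^sub>5\<rangle>\<close>; its
  coordinates form a symmetric matrix, called \<open>s\<close> for the first and \<open>t\<close> for the second member of a
  pair. In such coordinates the orbit closure looks like a Whitney umbrella: it carries an equation
  \<open>p\<^sup>2 = q\<^sup>2 r\<close> and contains points near which \<open>q\<close> is not identically zero, so that \<open>p / q\<close> is integral
  there. It also contains a curve through such points on which \<open>q = 0\<close> and \<open>r\<close> is a coordinate, hence
  not a square, so that \<open>p / q\<close> is not regular.

  In characteristic other than 2 the equation comes from \<open>M\<^sub>1\<^sub>1 n\<^sub>1\<^sup>2 + 2 M\<^sub>1\<^sub>2 n\<^sub>1 n\<^sub>2 + M\<^sub>2\<^sub>2 n\<^sub>2\<^sup>2 = 0\<close> with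
  \<open>n = (s13, - s12)\<close>, and \<open>r\<close> is minus the determinant of \<open>M\<close>. In characteristic 2 the orbit has smaller
  dimension: for each of its points a quadratic form polarising to \<open>\<omega>\<close> vanishes on both
  subspaces, and this gives \<open>s22 + t22 = c (s12 + t12)\<^sup>2\<close> and \<open>s33 + t33 = c (s13 + t13)\<^sup>2\<close> with the same
  \<open>c\<close>, whence the equation with \<open>q = s12 + t12\<close> and \<open>r = (s22 + t22) (s33 + t33)\<close>.
\<close>

section \<open>Square roots in integrally closed local rings\<close>

text \<open>The fraction \<open>p / q\<close> is a root of the monic polynomial
  \<open>X^2 - r\<close>, hence comes from some \<open>h\<close> in the ring; then
  \<open>p = h q\<close>, and \<open>q^2\<close> cancels.\<close>

lemma integrally_closed_domain_sqrt:
  fixes R (structure)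
  assumes R: "integrally_closed_domain R"
    and car: "p \<in> carrier R" "q \<in> carrier R" "r \<in> carrier R"
    and q: "q \<noteq> \<zero>" and eq: "p \<otimes> p = (q \<otimes> q) \<otimes> r"
  shows "\<exists>h\<in>carrier R. h \<otimes> h = r"
proof -
  have dom: "domain R" using R by (simp add: integrally_closed_domain_def)
  interpret domain R by (rule dom)
  define K where "K = fraction_field R"
  interpret K: field K unfolding K_def by (rule field_fraction_field[OF dom])
  let ?x = "frac R p q"
  let ?A = "(\<lambda>a. frac R a \<one>) ` carrier R"
  have o: "\<one>\<^bsub>K\<^esub> = frac R \<one> \<one>" "\<zero>\<^bsub>K\<^esub> = frac R \<zero> \<one>"
    by (simp_all add: K_def fraction_field_def)
  note add = add_frac[OF dom, folded K_def] and mult = mult_frac[OF dom, folded K_def]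
    and eqf = frac_eq[OF dom]
  have c: "frac R a b \<in> carrier K" if "a \<in> carrier R" "b \<in> carrier R" "b \<noteq> \<zero>" for a b
    using carrier_fraction_field[OF dom] that unfolding K_def by auto
  have xK: "?x \<in> carrier K" using car q by (intro c) auto
  let ?r = "frac R (\<ominus> r) \<one>"
  have rK: "?r \<in> carrier K" using car by (intro c) auto
  have qq: "q \<otimes> q \<noteq> \<zero>" using car q by (simp add: integral_iff)
  have "?x \<otimes>\<^bsub>K\<^esub> ?x \<oplus>\<^bsub>K\<^esub> ?r = \<zero>\<^bsub>K\<^esub>"
    using car q qq by (simp add: mult add o eqf eq l_minus r_minus r_neg m_ac)
  \<comment> \<open>Coefficient lists start with the leading coefficient, so this list encodes
    \<open>X^2 - r\<close>.\<close>
  then have ev: "ring.eval K [\<one>\<^bsub>K\<^esub>, \<zero>\<^bsub>K\<^esub>, ?r] ?x = \<zero>\<^bsub>K\<^esub>"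
    using xK rK by (simp add: K.eval.simps numeral_2_eq_2)
  have pol: "polynomial\<^bsub>K\<^esub> ?A [\<one>\<^bsub>K\<^esub>, \<zero>\<^bsub>K\<^esub>, ?r]"
    unfolding polynomial_def using car by (auto simp: o(1)[symmetric] o(2)[symmetric]) (auto simp: o)
  have "integral_over K ?A ?x" unfolding integral_over_def using pol ev by (intro exI[of _ "[\<one>\<^bsub>K\<^esub>, \<zero>\<^bsub>K\<^esub>, ?r]"]) simp
  with R xK have "?x \<in> ?A" unfolding integrally_closed_domain_def K_def Let_def by blast
  then obtain h where h: "h \<in> carrier R" "?x = frac R h \<one>" by blast
  then have ph: "p = h \<otimes> q" using car q by (simp add: eqf)
  have "(q \<otimes> q) \<otimes> (h \<otimes> h) = (q \<otimes> q) \<otimes> r" using eq car h unfolding ph by (simp add: m_ac)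
  then have "h \<otimes> h = r" using qq car h by (meson m_closed m_lcancel)
  then show ?thesis using h by blast
qed

text \<open>These closure properties make the functions regular near a point a ring and those
  vanishing near it an ideal. They hold for affine varieties, for \<open>X\<close> and for subsets
  with the induced structure, which can thus be treated uniformly.\<close>

locale space_with_functions =
  fixes T :: "'a topology" and reg :: "'a set \<Rightarrow> ('a \<Rightarrow> 'k::field) \<Rightarrow> bool"
  assumes reg_openin: "reg U f \<Longrightarrow> openin T U"
    and reg_subset: "\<lbrakk>reg U f; openin T V; V \<subseteq> U\<rbrakk> \<Longrightarrow> reg V f"
    and reg_const: "openin T U \<Longrightarrow> reg U (\<lambda>_. c)"
    and reg_add: "\<lbrakk>reg U f; reg U g\<rbrakk> \<Longrightarrow> reg U (\<lambda>x. f x + g x)"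
    and reg_mult: "\<lbrakk>reg U f; reg U g\<rbrakk> \<Longrightarrow> reg U (\<lambda>x. f x * g x)"
begin

lemma reg_diff:
  assumes "reg U f" "reg U g"
  shows "reg U (\<lambda>x. f x - g x)"
  using reg_add[OF assms(1) reg_mult[OF reg_const[OF reg_openin[OF assms(1)], of "-1"] assms(2)]]
  by simp

lemma functions_near_cring:
  assumes "y \<in> topspace T"
  shows "cring (functions_near T reg y)"
proof -
  let ?R = "functions_near T reg y"
  have I: "f \<in> carrier ?R \<Longrightarrow> g \<in> carrier ?R \<Longrightarrow> \<exists>U. openin T U \<and> y \<in> U \<and> reg U f \<and> reg U g" for f g
  proof -
    assume "f \<in> carrier ?R" "g \<in> carrier ?R"
    then obtain U V where "openin T U" "y \<in> U" "reg U f" "openin T V" "y \<in> V" "reg V g"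
      by (auto simp: functions_near_def)
    then show ?thesis
      by (intro exI[of _ "U \<inter> V"]) (auto intro: reg_subset)
  qed
  have const: "(\<lambda>_. c) \<in> carrier ?R" for c
    using assms reg_const[of "topspace T"] by (auto simp: functions_near_def)
  have add: "(\<lambda>x. f x + g x) \<in> carrier ?R" if "f \<in> carrier ?R" "g \<in> carrier ?R" for f g
    using I[OF that] reg_add by (auto simp: functions_near_def)
  have mult: "(\<lambda>x. f x * g x) \<in> carrier ?R" if "f \<in> carrier ?R" "g \<in> carrier ?R" for f g
    using I[OF that] reg_mult by (auto simp: functions_near_def)
  have s: "\<one>\<^bsub>?R\<^esub> = (\<lambda>_. 1)" "\<zero>\<^bsub>?R\<^esub> = (\<lambda>_. 0)"
    "f \<oplus>\<^bsub>?R\<^esub> g = (\<lambda>x. f x + g x)" "f \<otimes>\<^bsub>?R\<^esub> g = (\<lambda>x. f x * g x)" for f g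
    by (simp_all add: functions_near_def)
  have neg: "\<exists>g\<in>carrier ?R. (\<lambda>x. g x + f x) = (\<lambda>_. 0)" if "f \<in> carrier ?R" for f
    using mult[OF const[of "-1"] that] by (intro bexI[of _ "\<lambda>x. -1 * f x"]) auto
  have neg': "\<exists>g\<in>carrier ?R. (\<lambda>x. f x + g x) = (\<lambda>_. 0)" if "f \<in> carrier ?R" for f
    using neg[OF that] by (simp add: add.commute)
  show ?thesis
  proof (rule cringI)
    show "abelian_group ?R"
      by (rule abelian_groupI) (simp_all add: s const add neg' ac_simps)
    show "comm_monoid ?R"
      by (rule comm_monoidI) (simp_all add: s const mult ac_simps)
  qed (simp add: s distrib_right)
qed

lemma vanishing_near_ideal:
  assumes "y \<in> topspace T"
  shows "ideal (vanishing_near T reg y) (functions_near T reg y)"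
proof -
  let ?R = "functions_near T reg y" and ?I = "vanishing_near T reg y"
  interpret R: cring ?R by (rule functions_near_cring[OF assms])
  have s: "\<one>\<^bsub>?R\<^esub> = (\<lambda>_. 1)" "\<zero>\<^bsub>?R\<^esub> = (\<lambda>_. 0)"
    "f \<oplus>\<^bsub>?R\<^esub> g = (\<lambda>x. f x + g x)" "f \<otimes>\<^bsub>?R\<^esub> g = (\<lambda>x. f x * g x)" for f g
    by (simp_all add: functions_near_def)
  have mem: "f \<in> ?I \<longleftrightarrow> f \<in> carrier ?R \<and> (\<exists>U. openin T U \<and> y \<in> U \<and> (\<forall>x\<in>U. f x = 0))" for f
    by (auto simp: vanishing_near_def)
  have I0: "\<zero>\<^bsub>?R\<^esub> \<in> ?I" unfolding mem using assms by (intro conjI R.zero_closed exI[of _ "topspace T"]) (auto simp: s)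
  have Im: "f \<otimes>\<^bsub>?R\<^esub> g \<in> ?I" if "f \<in> ?I" "g \<in> carrier ?R" for f g
  proof -
    have "f \<otimes>\<^bsub>?R\<^esub> g \<in> carrier ?R" using that mem R.m_closed by blast
    with that show ?thesis unfolding mem s(4) by auto
  qed
  have Ia: "f \<oplus>\<^bsub>?R\<^esub> g \<in> ?I" if fg: "f \<in> ?I" "g \<in> ?I" for f g
  proof -
    obtain U V where "openin T U" "y \<in> U" "\<forall>x\<in>U. f x = 0" "openin T V" "y \<in> V" "\<forall>x\<in>V. g x = 0"
      using fg unfolding mem by auto
    then have "openin T (U \<inter> V) \<and> y \<in> U \<inter> V \<and> (\<forall>x\<in>U \<inter> V. (f \<oplus>\<^bsub>?R\<^esub> g) x = 0)"
      by (auto simp: s)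
    then show ?thesis using fg mem R.a_closed by meson
  qed
  have Ineg: "\<ominus>\<^bsub>?R\<^esub> f \<in> ?I" if "f \<in> ?I" for f
    using Im[OF that, of "\<ominus>\<^bsub>?R\<^esub> \<one>\<^bsub>?R\<^esub>"] that mem by (simp add: R.r_minus)
  have sub: "?I \<subseteq> carrier ?R" using mem by blast
  show ?thesis
  proof (rule idealI[OF R.ring_axioms])
    show "subgroup ?I (add_monoid ?R)"
    proof (rule group.subgroupI)
      show "group (add_monoid ?R)" by (rule R.add.group_axioms)
    qed (use sub I0 Ineg Ia in \<open>auto simp: a_inv_def\<close>)
    show "a \<in> ?I \<Longrightarrow> x \<in> carrier ?R \<Longrightarrow> x \<otimes>\<^bsub>?R\<^esub> a \<in> ?I" for a x
      using Im[of a x] by (simp add: s mult.commute)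
    show "a \<in> ?I \<Longrightarrow> x \<in> carrier ?R \<Longrightarrow> a \<otimes>\<^bsub>?R\<^esub> x \<in> ?I" for a x
      by (rule Im)
  qed
qed

text \<open>Applies \<open>integrally_closed_domain_sqrt\<close> to germs: the last assumption makes
  the germ of \<open>q\<close> nonzero, and the square root found there is represented by a function
  on a neighbourhood.\<close>

lemma local_ring_sqrt:
  assumes y: "y \<in> topspace T" and ic: "integrally_closed_domain (local_ring T reg y)"
    and U: "openin T U" "y \<in> U" and reg: "reg U p" "reg U q" "reg U r"
    and eq: "\<And>x. x \<in> U \<Longrightarrow> p x * p x = (q x * q x) * r x"
    and q: "\<And>V. openin T V \<Longrightarrow> y \<in> V \<Longrightarrow> \<exists>x\<in>V. q x \<noteq> 0"
  shows "\<exists>h V. openin T V \<and> y \<in> V \<and> reg V h \<and> (\<forall>x\<in>V. h x * h x = r x)"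
proof -
  let ?R = "functions_near T reg y" and ?I = "vanishing_near T reg y"
  interpret R: cring ?R by (rule functions_near_cring[OF y])
  interpret I: ideal ?I ?R by (rule vanishing_near_ideal[OF y])
  have s: "f \<otimes>\<^bsub>?R\<^esub> g = (\<lambda>x. f x * g x)" "f \<oplus>\<^bsub>?R\<^esub> g = (\<lambda>x. f x + g x)" for f g
    by (simp_all add: functions_near_def)
  have car: "p \<in> carrier ?R" "q \<in> carrier ?R" "r \<in> carrier ?R"
    using U reg by (auto simp: functions_near_def)
  let ?c = "\<lambda>f. ?I +>\<^bsub>?R\<^esub> f"
  let ?L = "local_ring T reg y"
  have cL: "carrier ?L = a_rcosets\<^bsub>?R\<^esub> ?I" "\<zero>\<^bsub>?L\<^esub> = ?I"
    by (simp_all add: local_ring_def FactRing_def)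
  have mL: "?c f \<otimes>\<^bsub>?L\<^esub> ?c g = ?c (f \<otimes>\<^bsub>?R\<^esub> g)" if "f \<in> carrier ?R" "g \<in> carrier ?R" for f g
    using that by (simp_all add: local_ring_def FactRing_def I.rcoset_mult_add)
  have cc: "?c f \<in> carrier ?L" if "f \<in> carrier ?R" for f
    using that by (auto simp: local_ring_def FactRing_def A_RCOSETS_defs a_r_coset_def)
  \<comment> \<open>Equality of cosets is agreement near \<open>y\<close>, which moves identities
    between functions and germs in both directions.\<close>
  have eqc: "?c f = ?c g \<longleftrightarrow> (\<exists>U. openin T U \<and> y \<in> U \<and> (\<forall>x\<in>U. f x = g x))"
    if fg: "f \<in> carrier ?R" "g \<in> carrier ?R" for f g
  proof -
    have neg: "\<ominus>\<^bsub>?R\<^esub> g = (\<lambda>x. - g x)"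
    proof (rule R.minus_equality)
      show "(\<lambda>x. - g x) \<oplus>\<^bsub>?R\<^esub> g = \<zero>\<^bsub>?R\<^esub>" by (simp add: functions_near_def)
      obtain V where V: "openin T V" "y \<in> V" "reg V g" using fg by (auto simp: functions_near_def)
      then have "reg V (\<lambda>x. (\<lambda>_. -1) x * g x)" by (intro reg_mult reg_const V)
      then have "reg V (\<lambda>x. - g x)" by simp
      then have "\<exists>U. openin T U \<and> y \<in> U \<and> reg U (\<lambda>x. - g x)" using V by blast
      then show "(\<lambda>x. - g x) \<in> carrier ?R" by (simp add: functions_near_def)
    qed (rule fg)
    have "?c f = ?c g \<longleftrightarrow> f \<ominus>\<^bsub>?R\<^esub> g \<in> ?I"
      by (rule R.quotient_eq_iff_same_a_r_cos[OF I.is_ideal fg, symmetric])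
    also have "\<dots> \<longleftrightarrow> (\<exists>U. openin T U \<and> y \<in> U \<and> (\<forall>x\<in>U. (f \<ominus>\<^bsub>?R\<^esub> g) x = 0))"
      unfolding vanishing_near_def using R.minus_closed[OF fg] by blast
    also have "f \<ominus>\<^bsub>?R\<^esub> g = (\<lambda>x. f x - g x)" unfolding a_minus_def neg s by simp
    finally show ?thesis unfolding right_minus_eq .
  qed
  have "?c p \<otimes>\<^bsub>?L\<^esub> ?c p = (?c q \<otimes>\<^bsub>?L\<^esub> ?c q) \<otimes>\<^bsub>?L\<^esub> ?c r"
  proof -
    have "?c (p \<otimes>\<^bsub>?R\<^esub> p) = ?c ((q \<otimes>\<^bsub>?R\<^esub> q) \<otimes>\<^bsub>?R\<^esub> r)"
      by (subst eqc) (use car R.m_closed in blast, use car R.m_closed in blast, unfold s, use U eq in blast)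
    then show ?thesis unfolding mL[OF car(1,1)] mL[OF car(2,2)] mL[OF R.m_closed[OF car(2,2)] car(3)] .
  qed
  moreover have "?c q \<noteq> \<zero>\<^bsub>?L\<^esub>"
  proof
    assume "?c q = \<zero>\<^bsub>?L\<^esub>"
    then have "q \<in> ?I" using I.a_rcos_self[OF car(2)] unfolding cL(2) by metis
    then obtain V where "openin T V" "y \<in> V" "\<forall>x\<in>V. q x = 0" unfolding vanishing_near_def by blast
    then show False using q by blast
  qed
  ultimately obtain H where H: "H \<in> carrier ?L" "H \<otimes>\<^bsub>?L\<^esub> H = ?c r"
    using integrally_closed_domain_sqrt[OF ic cc[OF car(1)] cc[OF car(2)] cc[OF car(3)]] by auto
  then obtain h where h: "h \<in> carrier ?R" "H = ?c h"
    unfolding cL A_RCOSETS_defs a_r_coset_def by auto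
  with H have "?c (h \<otimes>\<^bsub>?R\<^esub> h) = ?c r" unfolding mL[OF h(1,1), symmetric] by metis
  then obtain V where V: "openin T V" "y \<in> V" "\<forall>x\<in>V. h x * h x = r x"
    using eqc[OF R.m_closed[OF h(1) h(1)] car(3)] unfolding s by blast
  obtain W where W: "openin T W" "y \<in> W" "reg W h" using h(1) by (auto simp: functions_near_def)
  have VW: "openin T (V \<inter> W)" using V W by blast
  show ?thesis using V W VW reg_subset[OF W(3) VW] by (intro exI[of _ h] exI[of _ "V \<inter> W"]) auto
qed

end

section \<open>Regular functions and polynomial curves\<close>

lemma openin_zariski_nonvanishing:
  assumes "f \<in> polynomial_functions C"
  shows "openin (subtopology (zariski_topology C) V) {z \<in> V. f z \<noteq> 0}"
proof -
  have "openin (zariski_topology C) (- zero_locus {f})"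
    using assms by (auto simp: openin_zariski_topology)
  moreover have "{z \<in> V. f z \<noteq> 0} = - zero_locus {f} \<inter> V" by (auto simp: zero_locus_def)
  ultimately show ?thesis by (auto simp: openin_subtopology)
qed

lemma affine_regularI:
  assumes "openin (subtopology (zariski_topology C) V) U"
    and "\<And>x. x \<in> U \<Longrightarrow> \<exists>N a b. openin (subtopology (zariski_topology C) V) N \<and> x \<in> N \<and> N \<subseteq> U \<and>
        a \<in> polynomial_functions C \<and> b \<in> polynomial_functions C \<and> (\<forall>z\<in>N. b z \<noteq> 0 \<and> f z = a z / b z)"
  shows "affine_regular C V U f"
  using assms by (simp add: affine_regular_def)

lemma affine_regularE:
  assumes "affine_regular C V U f" "x \<in> U"
  obtains N a b where "openin (subtopology (zariski_topology C) V) N" "x \<in> N" "N \<subseteq> U"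
    "a \<in> polynomial_functions C" "b \<in> polynomial_functions C"
    "\<And>z. z \<in> N \<Longrightarrow> b z \<noteq> 0" "\<And>z. z \<in> N \<Longrightarrow> f z = a z / b z"
proof -
  have "\<exists>N a b. openin (subtopology (zariski_topology C) V) N \<and> x \<in> N \<and> N \<subseteq> U \<and>
      a \<in> polynomial_functions C \<and> b \<in> polynomial_functions C \<and> (\<forall>z\<in>N. b z \<noteq> 0 \<and> f z = a z / b z)"
    using assms by (simp add: affine_regular_def)
  then show ?thesis using that by blast
qed

lemma affine_regular_space:
  "space_with_functions (subtopology (zariski_topology C) V) (affine_regular C V)"
proof -
  let ?T = "subtopology (zariski_topology C) V"
  have opn: "openin ?T U" if "affine_regular C V U f" for U and f :: "'a \<Rightarrow> 'b"
    using that by (simp add: affine_regular_def)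
  have sub: "affine_regular C V U' f"
    if *: "affine_regular C V U f" "openin ?T U'" "U' \<subseteq> U" for U U' and f :: "'a \<Rightarrow> 'b"
  proof (rule affine_regularI[OF *(2)])
    fix x assume x: "x \<in> U'"
    then have "x \<in> U" using * by blast
    with *(1) obtain N a b where N: "openin ?T N" "x \<in> N" "N \<subseteq> U" "a \<in> polynomial_functions C"
      "b \<in> polynomial_functions C" "\<And>z. z \<in> N \<Longrightarrow> b z \<noteq> 0" "\<And>z. z \<in> N \<Longrightarrow> f z = a z / b z"
      by (rule affine_regularE) blast
    then show "\<exists>N a b. openin ?T N \<and> x \<in> N \<and> N \<subseteq> U' \<and> a \<in> polynomial_functions C \<and>
        b \<in> polynomial_functions C \<and> (\<forall>z\<in>N. b z \<noteq> 0 \<and> f z = a z / b z)"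
      using x *(2) by (rule_tac x="N \<inter> U'" in exI, rule_tac x=a in exI, rule_tac x=b in exI) auto
  qed
  have const: "affine_regular C V U (\<lambda>_. c)" if U: "openin ?T U" for U c
  proof (rule affine_regularI[OF U])
    fix x assume "x \<in> U"
    then show "\<exists>N a b. openin ?T N \<and> x \<in> N \<and> N \<subseteq> U \<and> a \<in> polynomial_functions C \<and>
        b \<in> polynomial_functions C \<and> (\<forall>z\<in>N. b z \<noteq> 0 \<and> c = a z / b z)"
      using U by (rule_tac x=U in exI, rule_tac x="\<lambda>_. c" in exI, rule_tac x="\<lambda>_. 1" in exI)
        (simp add: polynomial_functions.const)
  qed
  have ex: "\<exists>N a b c d. openin ?T N \<and> x \<in> N \<and> N \<subseteq> U \<and> a \<in> polynomial_functions C \<and>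
      b \<in> polynomial_functions C \<and> c \<in> polynomial_functions C \<and> d \<in> polynomial_functions C \<and>
      (\<forall>z\<in>N. b z \<noteq> 0 \<and> d z \<noteq> 0 \<and> f z = a z / b z \<and> g z = c z / d z)"
    if f: "affine_regular C V U f" and g: "affine_regular C V U g" and x: "x \<in> U"
    for U x and f g :: "'a \<Rightarrow> 'b"
  proof -
    obtain N a b where N: "openin ?T N" "x \<in> N" "N \<subseteq> U" "a \<in> polynomial_functions C"
        "b \<in> polynomial_functions C" "\<And>z. z \<in> N \<Longrightarrow> b z \<noteq> 0" "\<And>z. z \<in> N \<Longrightarrow> f z = a z / b z"
      using affine_regularE[OF f x] by metis
    obtain M c d where M: "openin ?T M" "x \<in> M" "M \<subseteq> U" "c \<in> polynomial_functions C"
        "d \<in> polynomial_functions C" "\<And>z. z \<in> M \<Longrightarrow> d z \<noteq> 0" "\<And>z. z \<in> M \<Longrightarrow> g z = c z / d z"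
      using affine_regularE[OF g x] by metis
    show ?thesis using N M
      by (rule_tac x="N \<inter> M" in exI, rule_tac x=a in exI, rule_tac x=b in exI, rule_tac x=c in exI, rule_tac x=d in exI) auto
  qed
  have add: "affine_regular C V U (\<lambda>x. f x + g x)"
    if f: "affine_regular C V U f" and g: "affine_regular C V U g" for U and f g :: "'a \<Rightarrow> 'b"
  proof (rule affine_regularI[OF opn[OF f]])
    fix x assume "x \<in> U"
    then obtain N a b c d where N: "openin ?T N" "x \<in> N" "N \<subseteq> U" "a \<in> polynomial_functions C"
      "b \<in> polynomial_functions C" "c \<in> polynomial_functions C" "d \<in> polynomial_functions C"
      "\<forall>z\<in>N. b z \<noteq> 0 \<and> d z \<noteq> 0 \<and> f z = a z / b z \<and> g z = c z / d z"
      using ex[OF f g, of x] by blast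
    then show "\<exists>N a b. openin ?T N \<and> x \<in> N \<and> N \<subseteq> U \<and> a \<in> polynomial_functions C \<and>
          b \<in> polynomial_functions C \<and> (\<forall>z\<in>N. b z \<noteq> 0 \<and> f z + g z = a z / b z)"
      by (rule_tac x=N in exI, rule_tac x="\<lambda>z. a z * d z + c z * b z" in exI, rule_tac x="\<lambda>z. b z * d z" in exI)
        (simp add: polynomial_functions.add polynomial_functions.mult add_frac_eq)
  qed
  have mult: "affine_regular C V U (\<lambda>x. f x * g x)"
    if f: "affine_regular C V U f" and g: "affine_regular C V U g" for U and f g :: "'a \<Rightarrow> 'b"
  proof (rule affine_regularI[OF opn[OF f]])
    fix x assume "x \<in> U"
    then obtain N a b c d where N: "openin ?T N" "x \<in> N" "N \<subseteq> U" "a \<in> polynomial_functions C"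
      "b \<in> polynomial_functions C" "c \<in> polynomial_functions C" "d \<in> polynomial_functions C"
      "\<forall>z\<in>N. b z \<noteq> 0 \<and> d z \<noteq> 0 \<and> f z = a z / b z \<and> g z = c z / d z"
      using ex[OF f g, of x] by blast
    then show "\<exists>N a b. openin ?T N \<and> x \<in> N \<and> N \<subseteq> U \<and> a \<in> polynomial_functions C \<and>
          b \<in> polynomial_functions C \<and> (\<forall>z\<in>N. b z \<noteq> 0 \<and> f z * g z = a z / b z)"
      by (rule_tac x=N in exI, rule_tac x="\<lambda>z. a z * c z" in exI, rule_tac x="\<lambda>z. b z * d z" in exI)
        (simp add: polynomial_functions.mult)
  qed
  show ?thesis
  proof (rule space_with_functions.intro, goal_cases)
    case (1 U f) then show ?case by (rule opn)
  next
    case (2 U f V) then show ?case by (rule sub)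
  next
    case (3 U c) then show ?case by (rule const)
  next
    case (4 U f g) then show ?case by (rule add)
  next
    case (5 U f g) then show ?case by (rule mult)
  qed
qed

text \<open>Where \<open>f = a / b\<close> with \<open>b\<close> nowhere zero, \<open>f\<close>
  vanishes exactly where \<open>a\<close> does, and nonvanishing of a polynomial function is an open
  condition.\<close>

lemma openin_affine_regular_nonvanishing:
  assumes f: "affine_regular C V U f"
  shows "openin (subtopology (zariski_topology C) V) {z \<in> U. f z \<noteq> 0}"
proof (subst openin_subopen, intro ballI)
  let ?T = "subtopology (zariski_topology C) V"
  fix x assume x: "x \<in> {z \<in> U. f z \<noteq> 0}"
  then have "x \<in> U" by simp
  then obtain N a b where N: "openin ?T N" "x \<in> N" "N \<subseteq> U" "a \<in> polynomial_functions C"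
        "b \<in> polynomial_functions C" "\<And>z. z \<in> N \<Longrightarrow> b z \<noteq> 0" "\<And>z. z \<in> N \<Longrightarrow> f z = a z / b z"
    using affine_regularE[OF f] by metis
  have V: "N \<subseteq> V" using openin_subset[OF N(1)] by auto
  have "openin ?T (N \<inter> {z \<in> V. a z \<noteq> 0})"
    using N(1) openin_zariski_nonvanishing[OF N(4)] by (rule openin_Int)
  moreover have "x \<in> N \<inter> {z \<in> V. a z \<noteq> 0}" using N(7)[OF N(2)] x V N(2) by auto
  moreover have "N \<inter> {z \<in> V. a z \<noteq> 0} \<subseteq> {z \<in> U. f z \<noteq> 0}" using N by auto
  ultimately show "\<exists>M. openin ?T M \<and> x \<in> M \<and> M \<subseteq> {z \<in> U. f z \<noteq> 0}" by blast
qed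

lemma induced_regular_space:
  assumes "space_with_functions T reg"
  shows "space_with_functions (subtopology T Y) (induced_regular T reg Y)"
proof -
  interpret space_with_functions T reg by fact
  let ?T = "subtopology T Y" and ?r = "induced_regular T reg Y"
  have opn: "openin ?T U" if "?r U f" for U f
    using that unfolding induced_regular_def by blast
  have sub: "?r U' f" if *: "?r U f" "openin ?T U'" "U' \<subseteq> U" for U U' f
    unfolding induced_regular_def
  proof (intro conjI ballI *(2))
    fix y assume "y \<in> U'"
    then have "y \<in> U" using *(3) by blast
    then obtain N F where "openin T N" "y \<in> N" "reg N F" "\<forall>x\<in>N \<inter> U. f x = F x"
      using *(1) unfolding induced_regular_def by blast
    then show "\<exists>N F. openin T N \<and> y \<in> N \<and> reg N F \<and> (\<forall>x\<in>N \<inter> U'. f x = F x)"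
      using *(3) by (rule_tac x=N in exI, rule_tac x=F in exI) auto
  qed
  have const: "?r U (\<lambda>_. c)" if U: "openin ?T U" for U c
  proof -
    obtain W where "openin T W" "U = W \<inter> Y" using U by (auto simp: openin_subtopology)
    then show ?thesis unfolding induced_regular_def using U reg_const by blast
  qed
  have ex: "\<exists>N F G. openin T N \<and> y \<in> N \<and> reg N F \<and> reg N G \<and> (\<forall>x\<in>N \<inter> U. f x = F x \<and> g x = G x)"
    if f: "?r U f" and g: "?r U g" and y: "y \<in> U" for U f g y
  proof -
    obtain N F where N: "openin T N" "y \<in> N" "reg N F" "\<forall>x\<in>N \<inter> U. f x = F x"
      using f y unfolding induced_regular_def by blast
    obtain M G where M: "openin T M" "y \<in> M" "reg M G" "\<forall>x\<in>M \<inter> U. g x = G x"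
      using g y unfolding induced_regular_def by blast
    have NM: "openin T (N \<inter> M)" using N M by blast
    show ?thesis using N M NM reg_subset[OF N(3) NM] reg_subset[OF M(3) NM]
      by (rule_tac x="N \<inter> M" in exI, rule_tac x=F in exI, rule_tac x=G in exI) auto
  qed
  have add: "?r U (\<lambda>x. f x + g x)" if f: "?r U f" and g: "?r U g" for U f g
    unfolding induced_regular_def
  proof (intro conjI ballI opn[OF f])
    fix y assume "y \<in> U"
    then obtain N F G where "openin T N \<and> y \<in> N \<and> reg N F \<and> reg N G \<and> (\<forall>x\<in>N \<inter> U. f x = F x \<and> g x = G x)"
      using ex[OF f g, of y] by blast
    then show "\<exists>N F. openin T N \<and> y \<in> N \<and> reg N F \<and> (\<forall>x\<in>N \<inter> U. f x + g x = F x)"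
      by (rule_tac x=N in exI, rule_tac x="\<lambda>x. F x + G x" in exI) (auto intro: reg_add)
  qed
  have mult: "?r U (\<lambda>x. f x * g x)" if f: "?r U f" and g: "?r U g" for U f g
    unfolding induced_regular_def
  proof (intro conjI ballI opn[OF f])
    fix y assume "y \<in> U"
    then obtain N F G where "openin T N \<and> y \<in> N \<and> reg N F \<and> reg N G \<and> (\<forall>x\<in>N \<inter> U. f x = F x \<and> g x = G x)"
      using ex[OF f g, of y] by blast
    then show "\<exists>N F. openin T N \<and> y \<in> N \<and> reg N F \<and> (\<forall>x\<in>N \<inter> U. f x * g x = F x)"
      by (rule_tac x=N in exI, rule_tac x="\<lambda>x. F x * G x" in exI) (auto intro: reg_mult)
  qed
  show ?thesis
  proof (rule space_with_functions.intro, goal_cases)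
    case (1 U f) then show ?case by (rule opn)
  next
    case (2 U f V) then show ?case by (rule sub)
  next
    case (3 U c) then show ?case by (rule const)
  next
    case (4 U f g) then show ?case by (rule add)
  next
    case (5 U f g) then show ?case by (rule mult)
  qed
qed

lemma induced_regular_Int:
  assumes "openin T U" "reg U f"
  shows "induced_regular T reg Y (U \<inter> Y) f"
  unfolding induced_regular_def using assms by (auto simp: openin_subtopology)

lemma X_regular_space: "space_with_functions (X_topology :: (('k::field ^ 6) set \<times> ('k ^ 6) set) topology) X_regular"
proof -
  interpret A: space_with_functions "subtopology (zariski_topology entries) (Sp6 \<times> Sp6)"
    "affine_regular (entries :: (_ \<Rightarrow> 'k) set) (Sp6 \<times> Sp6)"
    by (rule affine_regular_space)
  let ?pre = "\<lambda>U. {z \<in> Sp6 \<times> Sp6. orbit_map z \<in> U}"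
  \<comment> \<open>Openness of the preimage is part of \<open>affine_regular\<close>, so openness
    of \<open>U\<close> in the quotient topology reduces to
    \<open>U \<subseteq> X_space\<close>.\<close>
  have iff: "X_regular U f \<longleftrightarrow> U \<subseteq> X_space \<and> affine_regular entries (Sp6 \<times> Sp6) (?pre U) (\<lambda>z. f (orbit_map z))" for U :: "(('k ^ 6) set \<times> ('k ^ 6) set) set" and f :: "('k ^ 6) set \<times> ('k ^ 6) set \<Rightarrow> 'k"
    unfolding X_regular_def openin_X_topology o_def using A.reg_openin by blast
  have opn: "openin X_topology U" if "X_regular U f" for U :: "(('k ^ 6) set \<times> ('k ^ 6) set) set" and f :: "('k ^ 6) set \<times> ('k ^ 6) set \<Rightarrow> 'k"
    using that unfolding X_regular_def by blast
  have sub: "X_regular V f" if *: "X_regular U f" "openin X_topology V" "V \<subseteq> U" for U V :: "(('k ^ 6) set \<times> ('k ^ 6) set) set" and f :: "('k ^ 6) set \<times> ('k ^ 6) set \<Rightarrow> 'k"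
  proof -
    have "?pre V \<subseteq> ?pre U" using * by blast
    with * show ?thesis
      unfolding iff openin_X_topology by (intro conjI A.reg_subset[of "?pre U" _ "?pre V"]) blast+
  qed
  have const: "X_regular U (\<lambda>_. c)" if "openin X_topology U" for U :: "(('k ^ 6) set \<times> ('k ^ 6) set) set" and c :: 'k
    using that unfolding iff openin_X_topology by (intro conjI A.reg_const) blast+
  have add: "X_regular U (\<lambda>x. f x + g x)" if "X_regular U f" "X_regular U g" for U :: "(('k ^ 6) set \<times> ('k ^ 6) set) set" and f g :: "('k ^ 6) set \<times> ('k ^ 6) set \<Rightarrow> 'k"
    using that unfolding iff by (intro conjI A.reg_add) blast+
  have mult: "X_regular U (\<lambda>x. f x * g x)" if "X_regular U f" "X_regular U g" for U :: "(('k ^ 6) set \<times> ('k ^ 6) set) set" and f g :: "('k ^ 6) set \<times> ('k ^ 6) set \<Rightarrow> 'k"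
    using that unfolding iff by (intro conjI A.reg_mult) blast+
  show ?thesis
  proof (rule space_with_functions.intro, goal_cases)
    case (1 U f) then show ?case by (rule opn)
  next
    case (2 U f V) then show ?case by (rule sub)
  next
    case (3 U c) then show ?case by (rule const)
  next
    case (4 U f g) then show ?case by (rule add)
  next
    case (5 U f g) then show ?case by (rule mult)
  qed
qed

lemma openin_X_regular_nonvanishing:
  assumes "X_regular U f"
  shows "openin X_topology {x \<in> U. f x \<noteq> 0}"
proof -
  let ?V = "{z \<in> Sp6 \<times> Sp6. orbit_map z \<in> U}"
  have U: "U \<subseteq> X_space" and f: "affine_regular entries (Sp6 \<times> Sp6) ?V (f \<circ> orbit_map)"
    using assms unfolding X_regular_def openin_X_topology by blast+
  have eq: "{z \<in> Sp6 \<times> Sp6. orbit_map z \<in> {x \<in> U. f x \<noteq> 0}} = {z \<in> ?V. (f \<circ> orbit_map) z \<noteq> 0}"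
    by auto
  have "{x \<in> U. f x \<noteq> 0} \<subseteq> X_space" using U by blast
  then show ?thesis
    unfolding openin_X_topology eq using openin_affine_regular_nonvanishing[OF f] by blast
qed

text \<open>The points of \<open>U\<close> where \<open>f\<close> is nonzero form an open set of
  \<open>X\<close>; were it to contain a point of the closure of \<open>A\<close>, it would meet
  \<open>A\<close>.\<close>

lemma regular_eq_on_closure:
  assumes U: "X_regular U f" and z: "\<And>x. x \<in> A \<Longrightarrow> x \<in> U \<Longrightarrow> f x = 0"
    and x: "x \<in> X_topology closure_of A" "x \<in> U"
  shows "f x = 0"
proof (rule ccontr)
  assume "f x \<noteq> 0"
  then have "x \<in> {x \<in> U. f x \<noteq> 0}" using x by simp
  then have "\<exists>y. y \<in> A \<and> y \<in> {x \<in> U. f x \<noteq> 0}"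
    using x(1) openin_X_regular_nonvanishing[OF U] unfolding in_closure_of by meson
  then show False using z by blast
qed

text \<open>A morphism from the affine line, given on coordinate functions. Pulling back along such
  curves reduces questions about open sets and regular functions to polynomials in one
  variable.\<close>

definition polynomial_curve :: "('a \<Rightarrow> 'k::field) set \<Rightarrow> ('k \<Rightarrow> 'a) \<Rightarrow> bool" where
  "polynomial_curve C \<gamma> \<longleftrightarrow> (\<forall>f\<in>C. \<exists>P. \<forall>s. f (\<gamma> s) = poly P s)"

lemma polynomial_curve_polynomial_function:
  assumes "polynomial_curve C \<gamma>" "f \<in> polynomial_functions C"
  shows "\<exists>P. \<forall>s. f (\<gamma> s) = poly P s"
  using assms(2)
proof induction
  case (const c) show ?case by (rule_tac x="[:c:]" in exI) simp
next
  case (coord f) then show ?case using assms(1) by (simp add: polynomial_curve_def)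
next
  case (add f g)
  then obtain P Q where "\<forall>s. f (\<gamma> s) = poly P s" "\<forall>s. g (\<gamma> s) = poly Q s" by blast
  then show ?case by (rule_tac x="P + Q" in exI) simp
next
  case (mult f g)
  then obtain P Q where "\<forall>s. f (\<gamma> s) = poly P s" "\<forall>s. g (\<gamma> s) = poly Q s" by blast
  then show ?case by (rule_tac x="P * Q" in exI) simp
qed

text \<open>Some polynomial function that vanishes on \<open>V - N\<close> is nonzero at
  \<open>\<gamma> s0\<close>; \<open>P\<close> is its pullback.\<close>

lemma polynomial_curve_openin:
  assumes \<gamma>: "polynomial_curve C \<gamma>" "\<And>s. \<gamma> s \<in> V"
    and N: "openin (subtopology (zariski_topology C) V) N" "\<gamma> s0 \<in> N"
  shows "\<exists>P. poly P s0 \<noteq> 0 \<and> (\<forall>s. poly P s \<noteq> 0 \<longrightarrow> \<gamma> s \<in> N)"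
proof -
  obtain S where S: "S \<subseteq> polynomial_functions C" "N = - zero_locus S \<inter> V"
    using N(1) by (auto simp: openin_subtopology openin_zariski_topology)
  then obtain f where f: "f \<in> S" "f (\<gamma> s0) \<noteq> 0" using N(2) by (auto simp: zero_locus_def)
  then obtain P where "\<forall>s. f (\<gamma> s) = poly P s"
    using polynomial_curve_polynomial_function[OF \<gamma>(1)] S by blast
  then show ?thesis using f S \<gamma>(2) by (rule_tac x=P in exI) (fastforce simp: zero_locus_def)
qed

lemma X_curve_openin:
  assumes "polynomial_curve entries \<gamma>" "\<And>s. \<gamma> s \<in> Sp6 \<times> Sp6"
    and "openin X_topology N" "orbit_map (\<gamma> s0) \<in> N"
  shows "\<exists>P. poly P s0 \<noteq> 0 \<and> (\<forall>s. poly P s \<noteq> 0 \<longrightarrow> orbit_map (\<gamma> s) \<in> N)"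
  using polynomial_curve_openin[OF assms(1,2), of "{z \<in> Sp6 \<times> Sp6. orbit_map z \<in> N}" s0] assms
  unfolding openin_X_topology by auto

text \<open>Near \<open>\<gamma> s0\<close> the pullback of \<open>f\<close> to the group is a
  fraction of polynomial functions. These restrict to \<open>A\<close> and \<open>B\<close> on the
  curve, and \<open>P\<close> is nonzero only at parameters where the fraction represents
  \<open>f\<close>.\<close>

lemma X_curve_regular:
  assumes \<gamma>: "polynomial_curve entries \<gamma>" "\<And>s. \<gamma> s \<in> Sp6 \<times> Sp6"
    and N: "X_regular N f" "orbit_map (\<gamma> s0) \<in> N"
  shows "\<exists>P A B. poly P s0 \<noteq> 0 \<and>
    (\<forall>s. poly P s \<noteq> 0 \<longrightarrow> poly B s \<noteq> 0 \<and> f (orbit_map (\<gamma> s)) = poly A s / poly B s)"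
proof -
  let ?V = "{z \<in> Sp6 \<times> Sp6. orbit_map z \<in> N}"
  have f: "affine_regular entries (Sp6 \<times> Sp6) ?V (f \<circ> orbit_map)"
    using N(1) unfolding X_regular_def by blast
  have s0: "\<gamma> s0 \<in> ?V" using N(2) \<gamma>(2) by blast
  obtain M a b where M: "openin (subtopology (zariski_topology entries) (Sp6 \<times> Sp6)) M" "\<gamma> s0 \<in> M"
      "a \<in> polynomial_functions entries" "b \<in> polynomial_functions entries"
      "\<And>z. z \<in> M \<Longrightarrow> b z \<noteq> 0" "\<And>z. z \<in> M \<Longrightarrow> (f \<circ> orbit_map) z = a z / b z"
    by (rule affine_regularE[OF f s0]) blast
  obtain P where "poly P s0 \<noteq> 0" "\<forall>s. poly P s \<noteq> 0 \<longrightarrow> \<gamma> s \<in> M"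
    using polynomial_curve_openin[OF \<gamma> M(1,2)] by blast
  moreover obtain A where "\<forall>s. a (\<gamma> s) = poly A s"
    using polynomial_curve_polynomial_function[OF \<gamma>(1) M(3)] by blast
  moreover obtain B where "\<forall>s. b (\<gamma> s) = poly B s"
    using polynomial_curve_polynomial_function[OF \<gamma>(1) M(4)] by blast
  ultimately have "\<forall>s. poly P s \<noteq> 0 \<longrightarrow> poly B s \<noteq> 0 \<and> f (orbit_map (\<gamma> s)) = poly A s / poly B s"
    "poly P s0 \<noteq> 0"
    using M(5) M(6)[unfolded o_apply] by metis+
  then show ?thesis by blast
qed

section \<open>Polynomials over an algebraically closed field\<close>

lemma infinite_UNIV_alg_closed: "infinite (UNIV :: 'k::alg_closed_field set)"
proof
  assume fin: "finite (UNIV :: 'k set)"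
  \<comment> \<open>\<open>P\<close> vanishes at every element of the field, so \<open>P + 1\<close>
    would be a nonconstant polynomial without a root.\<close>
  define P :: "'k poly" where "P = (\<Prod>a\<in>UNIV. [:- a, 1:])"
  have "degree P = card (UNIV :: 'k set)"
    unfolding P_def by (subst degree_prod_eq_sum_degree) auto
  then have "degree P > 0" using fin by (simp add: card_gt_0_iff)
  then have "degree (P + 1) > 0" using degree_add_eq_left[of 1 P] by simp
  then obtain x where "poly (P + 1) x = 0" using alg_closed_imp_poly_has_root by blast
  moreover have "poly P x = 0" unfolding P_def poly_prod using fin by (auto intro!: prod_zero)
  ultimately show False by simp
qed

lemma poly_nonzero_point:
  fixes P :: "'k::alg_closed_field poly"
  assumes "P \<noteq> 0"
  shows "\<exists>s. s \<noteq> 0 \<and> poly P s \<noteq> 0"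
proof -
  have "finite (insert 0 {s. poly P s = 0})" using poly_roots_finite[OF assms] by simp
  then obtain s where "s \<notin> insert 0 {s. poly P s = 0}"
    using infinite_UNIV_alg_closed by (metis UNIV_I ex_new_if_finite)
  then show ?thesis by auto
qed

text \<open>Clearing denominators gives \<open>A^2 = X B^2\<close> as polynomials, where the left
  degree is even and the right degree odd.\<close>

lemma no_rational_sqrt:
  fixes P A B :: "'k::alg_closed_field poly"
  assumes P: "P \<noteq> 0"
    and B: "\<And>s. s \<noteq> 0 \<Longrightarrow> poly P s \<noteq> 0 \<Longrightarrow> poly B s \<noteq> 0"
    and eq: "\<And>s. s \<noteq> 0 \<Longrightarrow> poly P s \<noteq> 0 \<Longrightarrow> (poly A s / poly B s) * (poly A s / poly B s) = s"
  shows False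
proof -
  let ?X = "[:0, 1:] :: 'k poly"
  let ?D = "A * A - ?X * (B * B)"
  \<comment> \<open>The factor \<open>P\<close> absorbs the exceptional parameters; a polynomial
    vanishing at all nonzero elements of an infinite field is zero.\<close>
  have "poly (P * ?D) s = 0" if "s \<noteq> 0" for s
    using B[OF that] eq[OF that] by (cases "poly P s = 0") (auto simp: field_simps)
  then have "P * ?D = 0" using poly_nonzero_point[of "P * ?D"] by blast
  then have D: "A * A = ?X * (B * B)" using P by simp
  obtain s where "s \<noteq> 0" "poly P s \<noteq> 0" using poly_nonzero_point[OF P] by blast
  then have "poly B s \<noteq> 0" by (rule B)
  then have "B \<noteq> 0" by auto
  then have "degree (?X * (B * B)) = 1 + 2 * degree B"
    by (subst degree_mult_eq) (auto simp: degree_mult_eq)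
  moreover have "A \<noteq> 0" using D \<open>B \<noteq> 0\<close> by auto
  then have "degree (A * A) = 2 * degree A" by (simp add: degree_mult_eq)
  ultimately have "2 * degree A = 1 + 2 * degree B" using D by simp
  then show False by presburger
qed

section \<open>The symplectic group\<close>

lemma UNIV_6: "(UNIV :: 6 set) = {1, 2, 3, 4, 5, 6}"
proof (rule card_subset_eq[symmetric])
  have "card {1, 2, 3, 4, 5, 6 :: 6} = 6" by simp
  then show "card {1, 2, 3, 4, 5, 6 :: 6} = card (UNIV :: 6 set)" by simp
qed auto

lemma forall_6: "(\<forall>i::6. P i) \<longleftrightarrow> P 1 \<and> P 2 \<and> P 3 \<and> P 4 \<and> P 5 \<and> P 6"
proof -
  have "(\<forall>i::6. P i) \<longleftrightarrow> (\<forall>i\<in>UNIV. P i)" by simp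
  also have "\<dots> \<longleftrightarrow> P 1 \<and> P 2 \<and> P 3 \<and> P 4 \<and> P 5 \<and> P 6" unfolding UNIV_6 by blast
  finally show ?thesis .
qed

lemma sum_6: "(\<Sum>i\<in>UNIV. f (i::6)) = f 1 + f 2 + f 3 + f 4 + f 5 + f 6"
  unfolding UNIV_6 by (simp add: ac_simps)

definition vec6 :: "'k \<Rightarrow> 'k \<Rightarrow> 'k \<Rightarrow> 'k \<Rightarrow> 'k \<Rightarrow> 'k \<Rightarrow> 'k ^ 6" where
  "vec6 x1 x2 x3 x4 x5 x6 = (\<chi> i. if i = 1 then x1 else if i = 2 then x2 else if i = 3 then x3
     else if i = 4 then x4 else if i = 5 then x5 else x6)"

lemma vec6_nth [simp]:
  "vec6 x1 x2 x3 x4 x5 x6 $ 1 = x1" "vec6 x1 x2 x3 x4 x5 x6 $ 2 = x2" "vec6 x1 x2 x3 x4 x5 x6 $ 3 = x3"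
  "vec6 x1 x2 x3 x4 x5 x6 $ 4 = x4" "vec6 x1 x2 x3 x4 x5 x6 $ 5 = x5" "vec6 x1 x2 x3 x4 x5 x6 $ 6 = x6"
  by (simp_all add: vec6_def)

lemma e_nth:
  "e 1 = vec6 1 0 0 0 0 (0::'k::field)" "e (Suc 0) = vec6 1 0 0 0 0 (0::'k)" "e 2 = vec6 0 1 0 0 0 (0::'k)" "e 3 = vec6 0 0 1 0 0 (0::'k)"
  "e 4 = vec6 0 0 0 1 0 (0::'k)" "e 5 = vec6 0 0 0 0 1 (0::'k)" "e 6 = vec6 0 0 0 0 0 (1::'k)"
  by (simp_all add: vec_eq_iff forall_6 e_def axis_def)

definition cols6 :: "'k ^ 6 \<Rightarrow> 'k ^ 6 \<Rightarrow> 'k ^ 6 \<Rightarrow> 'k ^ 6 \<Rightarrow> 'k ^ 6 \<Rightarrow> 'k ^ 6 \<Rightarrow> 'k ^ 6 ^ 6" where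
  "cols6 f1 f2 f3 f4 f5 f6 = (\<chi> i. vec6 (f1 $ i) (f2 $ i) (f3 $ i) (f4 $ i) (f5 $ i) (f6 $ i))"

lemma matrix_vector_6:
  fixes g :: "'k::field ^ 6 ^ 6"
  shows "g *v x = x $ 1 *s column 1 g + x $ 2 *s column 2 g + x $ 3 *s column 3 g
     + x $ 4 *s column 4 g + x $ 5 *s column 5 g + x $ 6 *s column 6 g"
  by (simp add: vec_eq_iff matrix_vector_mult_def sum_6 column_def mult.commute)

lemma column_cols6 [simp]:
  "column 1 (cols6 f1 f2 f3 f4 f5 f6) = f1" "column 2 (cols6 f1 f2 f3 f4 f5 f6) = f2"
  "column 3 (cols6 f1 f2 f3 f4 f5 f6) = f3" "column 4 (cols6 f1 f2 f3 f4 f5 f6) = f4"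
  "column 5 (cols6 f1 f2 f3 f4 f5 f6) = f5" "column 6 (cols6 f1 f2 f3 f4 f5 f6) = f6"
  by (simp_all add: vec_eq_iff column_def cols6_def)

lemma \<omega>_antisym: "\<omega> y x = - \<omega> x (y :: 'k::field ^ 6)"
  by (simp add: \<omega>_expand algebra_simps)

lemma \<omega>_nondegenerate:
  assumes "\<And>y. \<omega> x y = 0"
  shows "x = 0"
  using assms[of "e 1"] assms[of "e 2"] assms[of "e 3"] assms[of "e 4"] assms[of "e 5"] assms[of "e 6"]
  by (simp add: \<omega>_expand e_nth vec_eq_iff forall_6)

text \<open>Nondegeneracy of \<open>\<omega>\<close> makes the kernel of a form-preserving map
  trivial, so invertibility is automatic.\<close>

lemma Sp6_I:
  fixes g :: "'k::field ^ 6 ^ 6"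
  assumes "\<And>x y. \<omega> (g *v x) (g *v y) = \<omega> x y"
  shows "g \<in> Sp6"
proof -
  have "x = 0" if "g *v x = 0" for x
  proof (rule \<omega>_nondegenerate)
    fix y show "\<omega> x y = 0" unfolding assms[of x y, symmetric] that by (simp add: \<omega>_expand)
  qed
  then have "\<exists>h. h ** g = mat 1" by (simp add: matrix_left_invertible_ker)
  then have "invertible g" by (simp add: invertible_left_inverse)
  then show ?thesis using assms by (simp add: Sp6_def)
qed

text \<open>By bilinearity and antisymmetry, the fifteen values on a symplectic basis determine the
  form. Membership of an explicit matrix thus becomes a finite check.\<close>

lemma cols6_Sp6:
  fixes f1 :: "'k::field ^ 6"
  assumes "\<omega> f1 f2 = 0" "\<omega> f1 f3 = 0" "\<omega> f1 f4 = 0" "\<omega> f1 f5 = 0" "\<omega> f1 f6 = 1"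
    "\<omega> f2 f3 = 0" "\<omega> f2 f4 = 0" "\<omega> f2 f5 = 1" "\<omega> f2 f6 = 0"
    "\<omega> f3 f4 = 1" "\<omega> f3 f5 = 0" "\<omega> f3 f6 = 0"
    "\<omega> f4 f5 = 0" "\<omega> f4 f6 = 0" "\<omega> f5 f6 = 0"
  shows "cols6 f1 f2 f3 f4 f5 f6 \<in> Sp6"
proof (rule Sp6_I)
  fix x y
  note a = \<omega>_antisym[of _ f1] \<omega>_antisym[of f3 f2] \<omega>_antisym[of f4 f2] \<omega>_antisym[of f5 f2] \<omega>_antisym[of f6 f2]
    \<omega>_antisym[of f4 f3] \<omega>_antisym[of f5 f3] \<omega>_antisym[of f6 f3] \<omega>_antisym[of f5 f4] \<omega>_antisym[of f6 f4]
    \<omega>_antisym[of f6 f5]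
  have r: "\<omega> f2 f1 = 0" "\<omega> f3 f1 = 0" "\<omega> f4 f1 = 0" "\<omega> f5 f1 = 0" "\<omega> f6 f1 = -1"
    "\<omega> f3 f2 = 0" "\<omega> f4 f2 = 0" "\<omega> f5 f2 = -1" "\<omega> f6 f2 = 0"
    "\<omega> f4 f3 = -1" "\<omega> f5 f3 = 0" "\<omega> f6 f3 = 0"
    "\<omega> f5 f4 = 0" "\<omega> f6 f4 = 0" "\<omega> f6 f5 = 0"
    using a assms by simp_all
  show "\<omega> (cols6 f1 f2 f3 f4 f5 f6 *v x) (cols6 f1 f2 f3 f4 f5 f6 *v y) = \<omega> x y"
    unfolding matrix_vector_6[of _ x] matrix_vector_6[of _ y] column_cols6 \<omega>_add \<omega>_scale assms r \<omega>_self
    by (simp add: \<omega>_expand algebra_simps)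
qed

section \<open>The standard flag and the action on Lagrangian subspaces\<close>

lemma vec6_basis: "(x :: 'k::field ^ 6) = (\<Sum>j = 1..6. x $ of_nat j *s e j)"
proof -
  have *: "{1..6::nat} = {1, 2, 3, 4, 5, 6}" by auto
  show ?thesis unfolding * by (simp add: vec_eq_iff forall_6 e_nth)
qed

lemma flag_eq:
  assumes "i \<le> 6"
  shows "flag i = {x :: 'k::field ^ 6. \<forall>j\<in>{1..6}. i < j \<longrightarrow> x $ of_nat j = 0}" (is "_ = ?R")
proof
  have "vec.subspace ?R" by (auto simp: vec.subspace_def)
  moreover have "e ` {1..i} \<subseteq> ?R"
  proof
    fix x :: "'k ^ 6" assume "x \<in> e ` {1..i}"
    then obtain k where k: "1 \<le> k" "k \<le> i" "x = e k" by auto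
    show "x \<in> ?R"
    proof (intro CollectI ballI impI)
      fix j :: nat assume j: "j \<in> {1..6}" "i < j"
      then have "k = 1 \<or> k = 2 \<or> k = 3 \<or> k = 4 \<or> k = 5"
        "j = 2 \<or> j = 3 \<or> j = 4 \<or> j = 5 \<or> j = 6" "k < j" using k by simp_all linarith+
      then show "x $ of_nat j = 0" unfolding k(3) by (elim disjE; simp add: e_nth)
    qed
  qed
  ultimately show "flag i \<subseteq> ?R" unfolding flag_def by (rule vec.span_minimal[rotated])
  show "?R \<subseteq> flag i"
  proof
    fix x assume x: "x \<in> ?R"
    have "(\<Sum>j = 1..6. x $ of_nat j *s e j) \<in> flag i" unfolding flag_def
    proof (rule vec.span_sum)
      fix j :: nat assume j: "j \<in> {1..6}"
      show "x $ of_nat j *s e j \<in> vec.span (e ` {1..i})"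
      proof (cases "i < j")
        case True then show ?thesis using x j by (simp add: vec.span_zero)
      next
        case False then show ?thesis using j by (intro vec.span_scale vec.span_base) auto
      qed
    qed
    then show "x \<in> flag i" using vec6_basis[of x] by simp
  qed
qed

lemma flag_mem:
  "(x :: 'k::field ^ 6) \<in> flag 1 \<longleftrightarrow> x $ 2 = 0 \<and> x $ 3 = 0 \<and> x $ 4 = 0 \<and> x $ 5 = 0 \<and> x $ 6 = 0"
  "x \<in> flag 2 \<longleftrightarrow> x $ 3 = 0 \<and> x $ 4 = 0 \<and> x $ 5 = 0 \<and> x $ 6 = 0"
  "x \<in> flag 3 \<longleftrightarrow> x $ 4 = 0 \<and> x $ 5 = 0 \<and> x $ 6 = 0"
  "x \<in> flag 4 \<longleftrightarrow> x $ 5 = 0 \<and> x $ 6 = 0"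
  "x \<in> flag 5 \<longleftrightarrow> x $ 6 = 0"
  "x \<in> flag 6"
proof -
  have *: "{1..6::nat} = {1, 2, 3, 4, 5, 6}" by auto
  show "x \<in> flag 1 \<longleftrightarrow> x $ 2 = 0 \<and> x $ 3 = 0 \<and> x $ 4 = 0 \<and> x $ 5 = 0 \<and> x $ 6 = 0"
    "x \<in> flag 2 \<longleftrightarrow> x $ 3 = 0 \<and> x $ 4 = 0 \<and> x $ 5 = 0 \<and> x $ 6 = 0"
    "x \<in> flag 3 \<longleftrightarrow> x $ 4 = 0 \<and> x $ 5 = 0 \<and> x $ 6 = 0"
    "x \<in> flag 4 \<longleftrightarrow> x $ 5 = 0 \<and> x $ 6 = 0"
    "x \<in> flag 5 \<longleftrightarrow> x $ 6 = 0"
    "x \<in> flag 6"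
    by (simp_all add: flag_eq * del: One_nat_def)
qed

lemma span_e123: "vec.span {e 1, e 2, e 3 :: 'k::field ^ 6} = flag 3"
proof -
  have *: "{1..3::nat} = {1, 2, 3}" by auto
  show ?thesis unfolding flag_def * by simp
qed

lemma linear_matrix6: "Vector_Spaces.linear (*s) (*s) ((*v) (g :: 'k::field ^ 6 ^ 6))"
  by (rule matrix_vector_mul_linear_gen)

lemma inj_Sp6: "g \<in> Sp6 \<Longrightarrow> inj ((*v) (g :: 'k::field ^ 6 ^ 6))"
  by (metis (mono_tags, lifting) Sp6_def mem_Collect_eq inj_matrix_vector_mult)

lemma dim_act:
  fixes g :: "'k::field ^ 6 ^ 6"
  assumes "g \<in> Sp6"
  shows "vec.dim (act g V) = vec.dim V"
  unfolding act_def using inj_Sp6[OF assms] inj_on_subset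
  by (intro vec.dim_image_eq[OF linear_matrix6]) blast

lemma subspace_act:
  fixes g :: "'k::field ^ 6 ^ 6"
  assumes "vec.subspace V"
  shows "vec.subspace (act g V)"
  unfolding act_def by (rule vec.linear_subspace_image[OF linear_matrix6 assms])

lemma dim_flag3: "vec.dim (flag 3 :: ('k::field ^ 6) set) = 3"
proof -
  have "e i \<in> cart_basis" for i :: nat unfolding e_def cart_basis_def by auto
  then have "vec.independent {e 1, e 2, e 3 :: 'k ^ 6}"
    by (intro vec.independent_mono[OF independent_cart_basis]) auto
  moreover have "card {e 1, e 2, e 3 :: 'k ^ 6} = 3"
    by (simp add: e_nth vec_eq_iff forall_6)
  ultimately show ?thesis unfolding span_e123[symmetric] vec.dim_span
    by (simp add: vec.dim_eq_card_independent)
qed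

lemma lagrangian_act:
  assumes "g \<in> Sp6" "lagrangian V"
  shows "lagrangian (act g V)"
  using assms dim_act[OF assms(1)] subspace_act[of V g]
  by (auto simp: lagrangian_def act_def Sp6_def)

lemma lagrangian_flag3: "lagrangian (flag 3 :: ('k::field ^ 6) set)"
  unfolding lagrangian_def dim_flag3
  by (auto simp: flag_mem(3) \<omega>_expand) (simp add: flag_def)

lemma orbit_map_flag: "orbit_map z = (act (fst z) (flag 3), act (snd z) (flag 3))"
  by (cases z) (simp add: orbit_map_def span_e123 del: One_nat_def)

lemma orbit_map_X_space: "z \<in> Sp6 \<times> Sp6 \<Longrightarrow> orbit_map z \<in> X_space"
  unfolding orbit_map_flag X_space_def by (auto intro: lagrangian_act lagrangian_flag3)

lemma topspace_X_topology: "topspace X_topology = (X_space :: (('k::field ^ 6) set \<times> ('k ^ 6) set) set)"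
proof
  show "topspace X_topology \<subseteq> (X_space :: (('k ^ 6) set \<times> ('k ^ 6) set) set)"
    using openin_topspace[of X_topology] unfolding openin_X_topology by blast
  have "{z \<in> Sp6 \<times> Sp6. orbit_map z \<in> X_space} = Sp6 \<times> (Sp6 :: ('k ^ 6 ^ 6) set)"
    using orbit_map_X_space by blast
  then have "openin X_topology (X_space :: (('k ^ 6) set \<times> ('k ^ 6) set) set)"
    unfolding openin_X_topology using openin_zariski_nonvanishing[OF polynomial_functions.const[of 1]]
    by (auto simp: fun_eq_iff)
  then show "(X_space :: (('k ^ 6) set \<times> ('k ^ 6) set) set) \<subseteq> topspace X_topology" by (rule openin_subset)
qed

text \<open>A symplectic matrix preserves dimension, so containment in a flag member already gives
  equality; upper triangularity therefore suffices.\<close>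

lemma Borel_I:
  fixes g :: "'k::field ^ 6 ^ 6"
  assumes g: "g \<in> Sp6" and col: "\<And>j. j \<in> {1..6} \<Longrightarrow> g *v e j \<in> flag j"
  shows "g \<in> Borel"
  unfolding Borel_def
proof (intro CollectI conjI g ballI)
  fix i :: nat assume i: "i \<in> {1..6}"
  have "act g (flag i) \<subseteq> flag i"
    unfolding flag_def act_def vec.linear_span_image[OF linear_matrix6, symmetric]
  proof (rule vec.span_minimal)
    show "(*v) g ` e ` {1..i} \<subseteq> vec.span (e ` {1..i})"
    proof clarsimp
      fix j :: nat assume "Suc 0 \<le> j" "j \<le> i"
      then have "g *v e j \<in> flag j" "flag j \<subseteq> (flag i :: ('k ^ 6) set)"
        using i col unfolding flag_def by (auto intro!: vec.span_mono image_mono simp: flag_def)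
      then show "g *v e j \<in> vec.span (e ` {Suc 0..i})" by (auto simp: flag_def)
    qed
  qed simp
  then show "act g (flag i) = flag i"
    by (intro vec.subspace_dim_equal subspace_act) (auto simp: flag_def dim_act[OF g])
qed

section \<open>A criterion for non-normality\<close>

text \<open>A neighbourhood of the end point contains the point with parameter \<open>s\<close>
  wherever a certain polynomial, nonzero at \<open>0\<close>, does not vanish; as the field is
  infinite, there is such an \<open>s \<noteq> 0\<close>.\<close>

lemma orbit_curve_in_closure:
  fixes \<delta> :: "'k::alg_closed_field \<Rightarrow> ('k ^ 6 ^ 6) \<times> ('k ^ 6 ^ 6)"
  assumes \<delta>: "polynomial_curve entries \<delta>" "\<And>s. \<delta> s \<in> Sp6 \<times> Sp6"
    and A: "\<And>s. s \<noteq> 0 \<Longrightarrow> orbit_map (\<delta> s) \<in> A"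
  shows "orbit_map (\<delta> 0) \<in> X_topology closure_of A"
  unfolding in_closure_of topspace_X_topology
proof (intro conjI allI impI orbit_map_X_space \<delta>(2))
  fix N assume "orbit_map (\<delta> 0) \<in> N \<and> openin X_topology N"
  then obtain P where P: "poly P 0 \<noteq> 0" "\<forall>s. poly P s \<noteq> 0 \<longrightarrow> orbit_map (\<delta> s) \<in> N"
    using X_curve_openin[OF \<delta>, of N 0] by blast
  then have "P \<noteq> 0" by auto
  then obtain s where "s \<noteq> 0" "poly P s \<noteq> 0" using poly_nonzero_point by blast
  then show "\<exists>y. y \<in> A \<and> y \<in> N" using P A by blast
qed

text \<open>
  Normality at \<open>y = \<gamma>(1)\<close> would make \<open>p / q\<close> regular near \<open>y\<close>, so \<open>r\<close> would have a regular square
  root along \<open>\<gamma>\<close>; but \<open>r\<close> restricts to the coordinate of \<open>\<gamma>\<close>, which is not a square of a rational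
  function.
\<close>

lemma not_normal_criterion:
  fixes \<gamma> :: "'k::alg_closed_field \<Rightarrow> ('k ^ 6 ^ 6) \<times> ('k ^ 6 ^ 6)"
  assumes reg: "X_regular U p" "X_regular U q" "X_regular U r"
    and eq: "\<And>x. x \<in> A \<Longrightarrow> x \<in> U \<Longrightarrow> p x * p x = (q x * q x) * r x"
    and \<gamma>: "polynomial_curve entries \<gamma>" "\<And>s. \<gamma> s \<in> Sp6 \<times> Sp6"
      "\<And>s. orbit_map (\<gamma> s) \<in> U" "\<And>s. r (orbit_map (\<gamma> s)) = s"
    and \<delta>: "\<And>m. polynomial_curve entries (\<delta> m)" "\<And>m s. \<delta> m s \<in> Sp6 \<times> Sp6"
      "\<And>m. orbit_map (\<delta> m 0) = orbit_map (\<gamma> (m * m))"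
      "\<And>m s. m \<noteq> 0 \<Longrightarrow> s \<noteq> 0 \<Longrightarrow> orbit_map (\<delta> m s) \<in> A"
      "\<And>m s. m \<noteq> 0 \<Longrightarrow> s \<noteq> 0 \<Longrightarrow> q (orbit_map (\<delta> m s)) \<noteq> 0"
  shows "\<not> normal_in_X (X_topology closure_of A)"
proof
  let ?Y = "X_topology closure_of A"
  let ?T = "subtopology X_topology ?Y" and ?r = "induced_regular X_topology X_regular ?Y"
  interpret X: space_with_functions X_topology "X_regular :: _ \<Rightarrow> (_ \<Rightarrow> 'k) \<Rightarrow> bool"
    by (rule X_regular_space)
  interpret Y: space_with_functions ?T ?r
    by (rule induced_regular_space[OF X_regular_space])
  have U: "openin X_topology U" by (rule X.reg_openin[OF reg(1)])
  \<comment> \<open>Every \<open>s\<close> is a square \<open>m * m\<close> in an algebraically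
    closed field, so for \<open>s \<noteq> 0\<close> the curve \<open>\<delta> m\<close>, which runs
    in \<open>A\<close>, ends at \<open>\<gamma> s\<close>.\<close>
  have \<gamma>Y: "orbit_map (\<gamma> s) \<in> ?Y" if "s \<noteq> 0" for s
  proof -
    obtain m where m: "m * m = s" using nth_root_exists[of 2 s] by (auto simp: power2_eq_square)
    then have "m \<noteq> 0" using that by auto
    then show ?thesis using orbit_curve_in_closure[OF \<delta>(1,2), of m A] \<delta>(3)[of m] \<delta>(4) m by auto
  qed
  define y where "y = orbit_map (\<gamma> 1)"
  have yY: "y \<in> ?Y" unfolding y_def by (rule \<gamma>Y) simp
  have y: "y \<in> topspace ?T"
    using yY orbit_map_X_space[OF \<gamma>(2), of 1] by (simp add: topspace_X_topology y_def)
  \<comment> \<open>The relation is the vanishing of one regular function, so it passes from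
    \<open>A\<close> to its closure.\<close>
  have eqY: "p x * p x = (q x * q x) * r x" if "x \<in> U \<inter> ?Y" for x
  proof -
    have "X_regular U (\<lambda>x. p x * p x + (\<lambda>_. -1) x * ((q x * q x) * r x))"
      by (intro X.reg_add X.reg_mult X.reg_const reg U)
    then have "p x * p x + (\<lambda>_. -1) x * ((q x * q x) * r x) = 0"
      by (rule regular_eq_on_closure[where A = A]) (use that in \<open>simp_all add: eq\<close>)
    then show ?thesis by simp
  qed
  \<comment> \<open>The curve \<open>\<delta> 1\<close> ends at \<open>y\<close>, so it has points
    of \<open>A\<close> with \<open>q \<noteq> 0\<close> in each neighbourhood of
    \<open>y\<close>.\<close>
  have qY: "\<exists>x\<in>V. q x \<noteq> 0" if V: "openin ?T V" "y \<in> V" for V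
  proof -
    obtain W where W: "openin X_topology W" "V = W \<inter> ?Y" using V by (auto simp: openin_subtopology)
    then have "orbit_map (\<delta> 1 0) \<in> W" using V \<delta>(3)[of 1] by (simp add: y_def)
    then obtain P where P: "poly P 0 \<noteq> 0" "\<forall>s. poly P s \<noteq> 0 \<longrightarrow> orbit_map (\<delta> 1 s) \<in> W"
      using X_curve_openin[OF \<delta>(1,2) W(1), of 1 0] by blast
    then have "P \<noteq> 0" by auto
    then obtain s where s: "s \<noteq> 0" "poly P s \<noteq> 0" using poly_nonzero_point by blast
    then have "orbit_map (\<delta> 1 s) \<in> A \<inter> topspace X_topology"
      using \<delta>(4) orbit_map_X_space[OF \<delta>(2)] by (simp add: topspace_X_topology)
    then have "orbit_map (\<delta> 1 s) \<in> V"
      using P s W closure_of_subset_Int[of X_topology A] by blast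
    then show ?thesis using \<delta>(5)[of 1 s] s by auto
  qed
  assume "normal_in_X ?Y"
  then have ic: "integrally_closed_domain (local_ring ?T ?r y)"
    using y unfolding normal_in_X_def normal_variety_def by blast
  have UY: "openin ?T (U \<inter> ?Y)" "y \<in> U \<inter> ?Y"
    using U \<gamma>(3) yY by (auto simp: openin_subtopology y_def)
  have ind: "?r (U \<inter> ?Y) f" if "X_regular U f" for f
    using U that by (rule induced_regular_Int)
  obtain h V where V: "openin ?T V" "y \<in> V" "?r V h" "\<forall>x\<in>V. h x * h x = r x"
    using Y.local_ring_sqrt[OF y ic UY ind[OF reg(1)] ind[OF reg(2)] ind[OF reg(3)] eqY qY] by blast
  \<comment> \<open>\<open>h\<close> is regular only on the closure, so near \<open>y\<close> it is
    replaced by an ambient regular function \<open>F\<close>; along \<open>\<gamma>\<close> this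
    \<open>F\<close> squares to the parameter.\<close>
  obtain N F where N: "openin X_topology N" "y \<in> N" "X_regular N F" "\<forall>x\<in>N \<inter> V. h x = F x"
    using V(2,3) unfolding induced_regular_def by blast
  obtain W where W: "openin X_topology W" "V = W \<inter> ?Y" using V by (auto simp: openin_subtopology)
  have NW: "openin X_topology (N \<inter> W)" "orbit_map (\<gamma> 1) \<in> N \<inter> W"
    using N W V by (auto simp: y_def)
  obtain P where P: "poly P 1 \<noteq> 0" "\<forall>s. poly P s \<noteq> 0 \<longrightarrow> orbit_map (\<gamma> s) \<in> N \<inter> W"
    using X_curve_openin[OF \<gamma>(1,2) NW] by blast
  have "orbit_map (\<gamma> 1) \<in> N" using NW by blast
  then obtain Q a b where Q: "poly Q 1 \<noteq> 0"
      "\<forall>s. poly Q s \<noteq> 0 \<longrightarrow> poly b s \<noteq> 0 \<and> F (orbit_map (\<gamma> s)) = poly a s / poly b s"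
    using X_curve_regular[OF \<gamma>(1,2) N(3)] by blast
  show False
  proof (rule no_rational_sqrt[of "P * Q" b a])
    show "P * Q \<noteq> 0" using P(1) Q(1) by auto
    fix s assume s: "s \<noteq> 0" "poly (P * Q) s \<noteq> 0"
    then have nz: "poly P s \<noteq> 0" "poly Q s \<noteq> 0" by auto
    then have mem: "orbit_map (\<gamma> s) \<in> N" "orbit_map (\<gamma> s) \<in> V"
      using P(2) W(2) \<gamma>Y[OF s(1)] by auto
    then have "F (orbit_map (\<gamma> s)) * F (orbit_map (\<gamma> s)) = s"
      using N(4) V(4) \<gamma>(4)[of s] by (metis IntI)
    then show "poly b s \<noteq> 0" "poly a s / poly b s * (poly a s / poly b s) = s"
      using Q(2) nz by auto
  qed
qed

section \<open>Chart coordinates on the Lagrangian Grassmannian\<close>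

text \<open>For a charted Lagrangian this vector exists and is unique. Entries 6, 3, 2 of
  \<open>coord 1 0 0 V\<close> are \<open>s11\<close>, \<open>s12\<close>, \<open>s13\<close>;
  entries 3, 2 of \<open>coord 0 1 0 V\<close> are \<open>s22\<close>, \<open>s23\<close>; entry 2
  of \<open>coord 0 0 1 V\<close> is \<open>s33\<close>.\<close>

definition coord :: "'k \<Rightarrow> 'k \<Rightarrow> 'k \<Rightarrow> ('k::field ^ 6) set \<Rightarrow> 'k ^ 6" where
  "coord a b c V = (THE v. v \<in> V \<and> v $ 1 = a \<and> v $ 4 = b \<and> v $ 5 = c)"

text \<open>For a Lagrangian this says that the projection to entries 1, 4, 5 is onto, that is, that
  \<open>V\<close> is transversal to the span of \<open>e 2\<close>, \<open>e 3\<close>,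
  \<open>e 6\<close>.\<close>

definition charted :: "('k::field ^ 6) set \<Rightarrow> bool" where
  "charted V \<longleftrightarrow> (\<exists>v\<in>V. v $ 1 = 1 \<and> v $ 4 = 0 \<and> v $ 5 = 0) \<and>
     (\<exists>v\<in>V. v $ 1 = 0 \<and> v $ 4 = 1 \<and> v $ 5 = 0) \<and> (\<exists>v\<in>V. v $ 1 = 0 \<and> v $ 4 = 0 \<and> v $ 5 = 1)"

text \<open>The entries 1, 4, 5 of \<open>v - w\<close> are zero, so pairing it with the three chart
  vectors of \<open>V\<close> reads off its other entries up to sign; isotropy makes them
  zero.\<close>

lemma charted_unique:
  fixes v w :: "'k::field ^ 6"
  assumes V: "lagrangian V" "charted V" and vw: "v \<in> V" "w \<in> V"
    and eq: "v $ 1 = w $ 1" "v $ 4 = w $ 4" "v $ 5 = w $ 5"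
  shows "v = w"
proof -
  have d: "v - w \<in> V" using V vw by (simp add: lagrangian_def vec.subspace_diff)
  obtain u1 u4 u5 where u: "u1 \<in> V" "u4 \<in> V" "u5 \<in> V"
    "u1 $ 1 = 1" "u1 $ 4 = 0" "u1 $ 5 = 0" "u4 $ 1 = 0" "u4 $ 4 = 1" "u4 $ 5 = 0"
    "u5 $ 1 = 0" "u5 $ 4 = 0" "u5 $ 5 = 1"
    using V(2) unfolding charted_def by blast
  have "\<omega> u1 (v - w) = 0" "\<omega> u4 (v - w) = 0" "\<omega> u5 (v - w) = 0"
    using V(1) d u(1-3) by (simp_all add: lagrangian_def)
  then show ?thesis using u(4-) eq by (simp add: \<omega>_expand vec_eq_iff forall_6)
qed

lemma coord_eq:
  assumes "lagrangian V" "charted V" "v \<in> V" "v $ 1 = a" "v $ 4 = b" "v $ 5 = c"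
  shows "coord a b c V = v"
  unfolding coord_def by (rule the_equality) (use assms charted_unique[OF assms(1,2)] in auto)

lemma coord_mem:
  fixes V :: "('k::field ^ 6) set"
  assumes V: "lagrangian V" "charted V"
  shows "coord a b c V \<in> V" "coord a b c V $ 1 = a" "coord a b c V $ 4 = b" "coord a b c V $ 5 = c"
proof -
  obtain u1 u4 u5 where u: "u1 \<in> V" "u4 \<in> V" "u5 \<in> V"
    "u1 $ 1 = 1" "u1 $ 4 = 0" "u1 $ 5 = 0" "u4 $ 1 = 0" "u4 $ 4 = 1" "u4 $ 5 = 0"
    "u5 $ 1 = 0" "u5 $ 4 = 0" "u5 $ 5 = 1"
    using V(2) unfolding charted_def by blast
  let ?v = "a *s u1 + b *s u4 + c *s u5"
  have v: "?v \<in> V" "?v $ 1 = a" "?v $ 4 = b" "?v $ 5 = c"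
    using V(1) u by (simp_all add: lagrangian_def vec.subspace_add vec.subspace_scale)
  show "coord a b c V \<in> V" "coord a b c V $ 1 = a" "coord a b c V $ 4 = b" "coord a b c V $ 5 = c"
    unfolding coord_eq[OF V v] by (fact v)+
qed

text \<open>Expanding \<open>v\<close> in the three chart vectors involves nine entries; isotropy
  identifies three pairs of them up to sign, which is the symmetry of the coordinate matrix.\<close>

lemma charted_coords:
  fixes V :: "('k::field ^ 6) set"
  assumes V: "lagrangian V" "charted V" and v: "v \<in> V"
  shows "v $ 6 = coord 1 0 0 V $ 6 * v $ 1 - coord 1 0 0 V $ 3 * v $ 4 - coord 1 0 0 V $ 2 * v $ 5"
    "v $ 3 = coord 1 0 0 V $ 3 * v $ 1 + coord 0 1 0 V $ 3 * v $ 4 + coord 0 1 0 V $ 2 * v $ 5"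
    "v $ 2 = coord 1 0 0 V $ 2 * v $ 1 + coord 0 1 0 V $ 2 * v $ 4 + coord 0 0 1 V $ 2 * v $ 5"
proof -
  define u1 u4 u5 where "u1 = coord 1 0 0 V" "u4 = coord 0 1 0 V" "u5 = coord 0 0 1 V"
  note u = coord_mem[OF V, of 1 0 0, folded u1_u4_u5_def] coord_mem[OF V, of 0 1 0, folded u1_u4_u5_def]
    coord_mem[OF V, of 0 0 1, folded u1_u4_u5_def]
  have "v = v $ 1 *s u1 + v $ 4 *s u4 + v $ 5 *s u5"
    by (rule charted_unique[OF V v])
      (use V(1) u in \<open>simp_all add: lagrangian_def vec.subspace_add vec.subspace_scale\<close>)
  then have *: "v $ i = v $ 1 * u1 $ i + v $ 4 * u4 $ i + v $ 5 * u5 $ i" for i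
    by (metis vector_add_component vector_smult_component)
  have "\<omega> u1 u4 = 0" "\<omega> u1 u5 = 0" "\<omega> u4 u5 = 0"
    using V(1) u by (auto simp: lagrangian_def)
  then have s: "u4 $ 6 = - u1 $ 3" "u5 $ 6 = - u1 $ 2" "u5 $ 3 = u4 $ 2"
    using u by (simp_all add: \<omega>_expand eq_neg_iff_add_eq_0 ac_simps)
  show "v $ 6 = coord 1 0 0 V $ 6 * v $ 1 - coord 1 0 0 V $ 3 * v $ 4 - coord 1 0 0 V $ 2 * v $ 5"
    "v $ 3 = coord 1 0 0 V $ 3 * v $ 1 + coord 0 1 0 V $ 3 * v $ 4 + coord 0 1 0 V $ 2 * v $ 5"
    "v $ 2 = coord 1 0 0 V $ 2 * v $ 1 + coord 0 1 0 V $ 2 * v $ 4 + coord 0 0 1 V $ 2 * v $ 5"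
    using *[of 6] *[of 3] *[of 2] s unfolding u1_u4_u5_def[symmetric] by (simp_all add: algebra_simps)
qed

section \<open>Minors and Cramer's rule\<close>

definition det3 :: "'k \<Rightarrow> 'k \<Rightarrow> 'k \<Rightarrow> 'k \<Rightarrow> 'k \<Rightarrow> 'k \<Rightarrow> 'k \<Rightarrow> 'k \<Rightarrow> 'k \<Rightarrow> 'k::comm_ring_1" where
  "det3 a1 a2 a3 b1 b2 b3 c1 c2 c3 =
     a1 * (b2 * c3 - b3 * c2) - a2 * (b1 * c3 - b3 * c1) + a3 * (b1 * c2 - b2 * c1)"

lemma det3_mult:
  "det3 (x1 * a1 + x2 * a2 + x3 * a3) (y1 * a1 + y2 * a2 + y3 * a3) (z1 * a1 + z2 * a2 + z3 * a3)
     (x1 * b1 + x2 * b2 + x3 * b3) (y1 * b1 + y2 * b2 + y3 * b3) (z1 * b1 + z2 * b2 + z3 * b3)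
     (x1 * c1 + x2 * c2 + x3 * c3) (y1 * c1 + y2 * c2 + y3 * c3) (z1 * c1 + z2 * c2 + z3 * c3)
   = det3 a1 a2 a3 b1 b2 b3 c1 c2 c3 * det3 x1 y1 z1 x2 y2 z2 x3 y3 (z3 :: 'k::comm_ring_1)"
  by (simp add: det3_def algebra_simps)

definition chart_minor :: "'k::field ^ 6 ^ 6 \<Rightarrow> 'k" where
  "chart_minor g = det3 (g $ 1 $ 1) (g $ 1 $ 2) (g $ 1 $ 3) (g $ 4 $ 1) (g $ 4 $ 2) (g $ 4 $ 3)
     (g $ 5 $ 1) (g $ 5 $ 2) (g $ 5 $ 3)"

text \<open>Cramer's rule: \<open>coord a b c\<close> of the column space is this vector divided by \<^const>\<open>chart_minor\<close>.\<close>

definition coord_numerator :: "'k \<Rightarrow> 'k \<Rightarrow> 'k \<Rightarrow> 'k::field ^ 6 ^ 6 \<Rightarrow> 6 \<Rightarrow> 'k" where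
  "coord_numerator a b c g j =
     det3 a (g $ 1 $ 2) (g $ 1 $ 3) b (g $ 4 $ 2) (g $ 4 $ 3) c (g $ 5 $ 2) (g $ 5 $ 3) * g $ j $ 1 +
     det3 (g $ 1 $ 1) a (g $ 1 $ 3) (g $ 4 $ 1) b (g $ 4 $ 3) (g $ 5 $ 1) c (g $ 5 $ 3) * g $ j $ 2 +
     det3 (g $ 1 $ 1) (g $ 1 $ 2) a (g $ 4 $ 1) (g $ 4 $ 2) b (g $ 5 $ 1) (g $ 5 $ 2) c * g $ j $ 3"

lemma act_flag3:
  fixes g :: "'k::field ^ 6 ^ 6"
  shows "v \<in> act g (flag 3) \<longleftrightarrow> (\<exists>x y z. \<forall>j. v $ j = x * g $ j $ 1 + y * g $ j $ 2 + z * g $ j $ 3)"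
proof
  assume "v \<in> act g (flag 3)"
  then obtain w where "w \<in> flag 3" "v = g *v w" by (auto simp: act_def)
  then show "\<exists>x y z. \<forall>j. v $ j = x * g $ j $ 1 + y * g $ j $ 2 + z * g $ j $ 3"
    by (intro exI[of _ "w $ 1"] exI[of _ "w $ 2"] exI[of _ "w $ 3"])
      (simp add: flag_mem matrix_vector_6 column_def)
next
  assume "\<exists>x y z. \<forall>j. v $ j = x * g $ j $ 1 + y * g $ j $ 2 + z * g $ j $ 3"
  then obtain x y z where "\<And>j. v $ j = x * g $ j $ 1 + y * g $ j $ 2 + z * g $ j $ 3" by blast
  then have "v = g *v vec6 x y z 0 0 0" by (simp add: vec_eq_iff matrix_vector_6 column_def)
  moreover have "vec6 x y z 0 0 0 \<in> flag 3" by (simp add: flag_mem)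
  ultimately show "v \<in> act g (flag 3)" by (auto simp: act_def)
qed

lemma coord_numerator_mem:
  fixes g :: "'k::field ^ 6 ^ 6" and a b c :: 'k
  assumes "chart_minor g \<noteq> 0"
  defines "v \<equiv> \<chi> j. coord_numerator a b c g j / chart_minor g"
  shows "v \<in> act g (flag 3)" "v $ 1 = a" "v $ 4 = b" "v $ 5 = c"
proof -
  have "v $ j = (det3 a (g $ 1 $ 2) (g $ 1 $ 3) b (g $ 4 $ 2) (g $ 4 $ 3) c (g $ 5 $ 2) (g $ 5 $ 3) / chart_minor g) * g $ j $ 1 +
     (det3 (g $ 1 $ 1) a (g $ 1 $ 3) (g $ 4 $ 1) b (g $ 4 $ 3) (g $ 5 $ 1) c (g $ 5 $ 3) / chart_minor g) * g $ j $ 2 +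
     (det3 (g $ 1 $ 1) (g $ 1 $ 2) a (g $ 4 $ 1) (g $ 4 $ 2) b (g $ 5 $ 1) (g $ 5 $ 2) c / chart_minor g) * g $ j $ 3" for j
    unfolding v_def coord_numerator_def by (simp add: add_divide_distrib)
  then show "v \<in> act g (flag 3)" unfolding act_flag3 by blast
  have "coord_numerator a b c g 1 = a * chart_minor g" "coord_numerator a b c g 4 = b * chart_minor g"
    "coord_numerator a b c g 5 = c * chart_minor g"
    by (simp_all add: coord_numerator_def chart_minor_def det3_def algebra_simps)
  then show "v $ 1 = a" "v $ 4 = b" "v $ 5 = c" using assms(1) by (simp_all add: v_def)
qed

text \<open>The coefficients of the chart vectors in the first three columns give a right inverse of
  the submatrix, so the two determinants multiply to 1. Conversely, Cramer's rule produces the chart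
  vectors.\<close>

lemma charted_act_iff:
  fixes g :: "'k::field ^ 6 ^ 6"
  shows "charted (act g (flag 3)) \<longleftrightarrow> chart_minor g \<noteq> 0"
proof
  assume "charted (act g (flag 3))"
  then obtain u v w where m: "u \<in> act g (flag 3)" "v \<in> act g (flag 3)" "w \<in> act g (flag 3)"
    and c: "u $ 1 = 1" "u $ 4 = 0" "u $ 5 = 0" "v $ 1 = 0" "v $ 4 = 1" "v $ 5 = 0"
    "w $ 1 = 0" "w $ 4 = 0" "w $ 5 = 1"
    unfolding charted_def by blast
  obtain x1 x2 x3 where x: "\<And>j. u $ j = x1 * g $ j $ 1 + x2 * g $ j $ 2 + x3 * g $ j $ 3"
    using m unfolding act_flag3 by blast
  obtain y1 y2 y3 where y: "\<And>j. v $ j = y1 * g $ j $ 1 + y2 * g $ j $ 2 + y3 * g $ j $ 3"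
    using m unfolding act_flag3 by blast
  obtain z1 z2 z3 where z: "\<And>j. w $ j = z1 * g $ j $ 1 + z2 * g $ j $ 2 + z3 * g $ j $ 3"
    using m unfolding act_flag3 by blast
  have "chart_minor g * det3 x1 y1 z1 x2 y2 z2 x3 y3 z3 = det3 (u $ 1) (v $ 1) (w $ 1) (u $ 4) (v $ 4) (w $ 4) (u $ 5) (v $ 5) (w $ 5)"
    unfolding x y z chart_minor_def det3_mult ..
  also have "\<dots> = 1" unfolding c by (simp add: det3_def)
  finally show "chart_minor g \<noteq> 0" by auto
next
  assume "chart_minor g \<noteq> 0"
  from coord_numerator_mem[OF this, of 1 0 0] coord_numerator_mem[OF this, of 0 1 0]
    coord_numerator_mem[OF this, of 0 0 1]
  show "charted (act g (flag 3))" unfolding charted_def by blast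
qed

section \<open>Regularity of the chart coordinates\<close>

lemma polynomial_functions_diff:
  assumes "f \<in> polynomial_functions C" "g \<in> polynomial_functions C"
  shows "(\<lambda>x. f x - g x) \<in> polynomial_functions C"
  using polynomial_functions.add[OF assms(1)
      polynomial_functions.mult[OF polynomial_functions.const[of "-1"] assms(2)]] by simp

lemma polynomial_functions_entries:
  "(\<lambda>z. fst z $ i $ j) \<in> polynomial_functions entries"
  "(\<lambda>z. snd z $ i $ j) \<in> polynomial_functions entries"
  by (rule polynomial_functions.coord, force simp: entries_def)+

lemmas polynomial_functions_intros = polynomial_functions.add polynomial_functions.mult
  polynomial_functions_diff polynomial_functions.const polynomial_functions_entries

definition charts :: "(('k::field ^ 6) set \<times> ('k ^ 6) set) set" where
  "charts = {x \<in> X_space. charted (fst x) \<and> charted (snd x)}"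

lemma preimage_charts:
  "{z \<in> Sp6 \<times> Sp6. orbit_map z \<in> charts}
    = {z \<in> Sp6 \<times> Sp6. chart_minor (fst z) * chart_minor (snd z :: 'k::field ^ 6 ^ 6) \<noteq> 0}"
  using orbit_map_X_space by (auto simp: charts_def orbit_map_flag charted_act_iff)

lemma openin_preimage_charts:
  "openin (subtopology (zariski_topology entries) (Sp6 \<times> Sp6)) {z \<in> Sp6 \<times> Sp6. orbit_map z \<in> (charts :: (('k::field ^ 6) set \<times> ('k ^ 6) set) set)}"
  unfolding preimage_charts
  by (rule openin_zariski_nonvanishing)
    (unfold chart_minor_def det3_def, intro polynomial_functions_intros)

lemma X_regular_charts_I:
  fixes f :: "('k::field ^ 6) set \<times> ('k ^ 6) set \<Rightarrow> 'k"
  assumes "a \<in> polynomial_functions entries" "b \<in> polynomial_functions entries"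
    and "\<And>z. z \<in> Sp6 \<times> Sp6 \<Longrightarrow> orbit_map z \<in> charts \<Longrightarrow> b z \<noteq> 0 \<and> f (orbit_map z) = a z / b z"
  shows "X_regular charts f"
  unfolding X_regular_def openin_X_topology
proof (intro conjI openin_preimage_charts affine_regularI)
  show "charts \<subseteq> X_space" by (auto simp: charts_def)
  fix z :: "('k ^ 6 ^ 6) \<times> ('k ^ 6 ^ 6)" assume z: "z \<in> {z \<in> Sp6 \<times> Sp6. orbit_map z \<in> charts}"
  show "\<exists>N a b. openin (subtopology (zariski_topology entries) (Sp6 \<times> Sp6)) N \<and> z \<in> N \<and>
      N \<subseteq> {z \<in> Sp6 \<times> Sp6. orbit_map z \<in> charts} \<and> a \<in> polynomial_functions entries \<and>
      b \<in> polynomial_functions entries \<and> (\<forall>z\<in>N. b z \<noteq> 0 \<and> (f \<circ> orbit_map) z = a z / b z)"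
    by (rule exI, rule exI[of _ a], rule exI[of _ b], rule conjI[OF openin_preimage_charts])
      (use z assms in auto)
qed

text \<open>Pulled back to the group, Cramer's rule expresses each coordinate by one fraction on the
  whole chart, with denominator \<open>chart_minor\<close>.\<close>

lemma X_regular_coord:
  fixes a b c :: "'k::field"
  shows "X_regular charts (\<lambda>x. coord a b c (fst x) $ j)" "X_regular charts (\<lambda>x. coord a b c (snd x) $ j)"
proof -
  have *: "chart_minor g \<noteq> 0 \<and> coord a b c (act g (flag 3)) $ j = coord_numerator a b c g j / chart_minor g"
    if g: "g \<in> Sp6" "charted (act g (flag 3))" for g :: "'k ^ 6 ^ 6"
  proof -
    have m: "chart_minor g \<noteq> 0" using g(2) by (simp add: charted_act_iff)
    show ?thesis
      using m coord_eq[OF lagrangian_act[OF g(1) lagrangian_flag3] g(2) coord_numerator_mem[OF m, of a b c]]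
      by simp
  qed
  show "X_regular charts (\<lambda>x. coord a b c (fst x) $ j)"
    by (rule X_regular_charts_I[of "\<lambda>z. coord_numerator a b c (fst z) j" "\<lambda>z. chart_minor (fst z)"])
      (unfold coord_numerator_def chart_minor_def det3_def, intro polynomial_functions_intros,
       intro polynomial_functions_intros,
       fold det3_def, fold coord_numerator_def chart_minor_def,
       use * in \<open>auto simp: charts_def orbit_map_flag\<close>)
  show "X_regular charts (\<lambda>x. coord a b c (snd x) $ j)"
    by (rule X_regular_charts_I[of "\<lambda>z. coord_numerator a b c (snd z) j" "\<lambda>z. chart_minor (snd z)"])
      (unfold coord_numerator_def chart_minor_def det3_def, intro polynomial_functions_intros,
       intro polynomial_functions_intros,
       fold det3_def, fold coord_numerator_def chart_minor_def,
       use * in \<open>auto simp: charts_def orbit_map_flag\<close>)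
qed

text \<open>A section over the chart: the first three columns span the Lagrangian with these
  coordinates, and the others complete them to a symplectic basis. Its entries are polynomial, so
  polynomial curves in the coordinates lift to the group.\<close>

definition chart_lift :: "'k \<Rightarrow> 'k \<Rightarrow> 'k \<Rightarrow> 'k \<Rightarrow> 'k \<Rightarrow> 'k \<Rightarrow> 'k::comm_ring_1 ^ 6 ^ 6" where
  "chart_lift s11 s12 s13 s22 s23 s33 = cols6 (vec6 1 s13 s12 0 0 s11) (vec6 0 s23 s22 1 0 (- s12))
     (vec6 0 s33 s23 0 1 (- s13)) (vec6 0 (-1) 0 0 0 0) (vec6 0 0 (-1) 0 0 0) (vec6 0 0 0 0 0 1)"

lemma chart_lift_Sp6: "chart_lift (s11 :: 'k::field) s12 s13 s22 s23 s33 \<in> Sp6"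
  unfolding chart_lift_def by (rule cols6_Sp6) (simp_all add: \<omega>_expand)

lemma act_chart_lift:
  fixes v :: "'k::field ^ 6"
  shows "v \<in> act (chart_lift s11 s12 s13 s22 s23 s33) (flag 3) \<longleftrightarrow>
    v $ 2 = s13 * v $ 1 + s23 * v $ 4 + s33 * v $ 5 \<and> v $ 3 = s12 * v $ 1 + s22 * v $ 4 + s23 * v $ 5 \<and>
    v $ 6 = s11 * v $ 1 - s12 * v $ 4 - s13 * v $ 5"
proof -
  have "v \<in> act (chart_lift s11 s12 s13 s22 s23 s33) (flag 3) \<longleftrightarrow>
      (\<exists>x y z. v $ 1 = x \<and> v $ 4 = y \<and> v $ 5 = z \<and> v $ 2 = s13 * x + s23 * y + s33 * z \<and>
        v $ 3 = s12 * x + s22 * y + s23 * z \<and> v $ 6 = s11 * x - s12 * y - s13 * z)"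
    unfolding act_flag3 forall_6 by (simp add: chart_lift_def cols6_def algebra_simps)
  then show ?thesis by blast
qed

lemma charted_chart_lift: "charted (act (chart_lift (s11 :: 'k::field) s12 s13 s22 s23 s33) (flag 3))"
  unfolding charted_act_iff by (simp add: chart_minor_def det3_def chart_lift_def cols6_def)

lemma coord_chart_lift:
  "coord a b c (act (chart_lift (s11 :: 'k::field) s12 s13 s22 s23 s33) (flag 3)) =
    vec6 a (s13 * a + s23 * b + s33 * c) (s12 * a + s22 * b + s23 * c) b c (s11 * a - s12 * b - s13 * c)"
  by (rule coord_eq[OF lagrangian_act[OF chart_lift_Sp6 lagrangian_flag3] charted_chart_lift])
    (simp_all add: act_chart_lift)

lemma orbit_map_chart_lift:
  "orbit_map (chart_lift (a1 :: 'k::field) a2 a3 a4 a5 a6, chart_lift b1 b2 b3 b4 b5 b6) \<in> charts"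
  using orbit_map_X_space[of "(chart_lift a1 a2 a3 a4 a5 a6, chart_lift b1 b2 b3 b4 b5 b6)"]
  by (simp add: charts_def orbit_map_flag charted_chart_lift chart_lift_Sp6)

lemma polynomial_curve_chart_lift:
  "polynomial_curve entries (\<lambda>s :: 'k::field. (chart_lift (poly p1 s) (poly p2 s) (poly p3 s) (poly p4 s) (poly p5 s) (poly p6 s),
     chart_lift (poly q1 s) (poly q2 s) (poly q3 s) (poly q4 s) (poly q5 s) (poly q6 s)))"
proof -
  have *: "\<forall>i j. chart_lift (poly p1 s) (poly p2 s) (poly p3 s) (poly p4 s) (poly p5 s) (poly p6 s) $ i $ j
      = poly (chart_lift p1 p2 p3 p4 p5 p6 $ i $ j) s" for p1 p2 p3 p4 p5 p6 and s :: 'k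
    unfolding forall_6 by (simp add: chart_lift_def cols6_def)
  show ?thesis
    unfolding polynomial_curve_def entries_def using * by auto
qed

section \<open>The orbit of the base point\<close>

lemma lagrangian_eq:
  assumes "lagrangian V" "lagrangian W" "V \<subseteq> W"
  shows "V = W"
  using assms by (intro vec.subspace_dim_equal) (auto simp: lagrangian_def)

lemma Borel_mem_flag:
  assumes "b \<in> Borel" "j \<in> {1..6}"
  shows "b *v e j \<in> flag j"
proof -
  have "e j \<in> flag j" unfolding flag_def using assms(2) by (intro vec.span_base) auto
  then have "b *v e j \<in> act b (flag j)" unfolding act_def by (rule imageI)
  then show ?thesis using assms by (simp add: Borel_def)
qed

lemma base_point_fst:
  "vec.span {e 3, e 1 + e 5, e 2 + e 6} = {v :: 'k::field ^ 6. v $ 4 = 0 \<and> v $ 5 = v $ 1 \<and> v $ 6 = v $ 2}"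
  (is "vec.span ?S = ?R")
proof
  have "vec.subspace ?R" by (auto simp: vec.subspace_def)
  moreover have "?S \<subseteq> ?R" by (auto simp: e_nth)
  ultimately show "vec.span ?S \<subseteq> ?R" by (rule vec.span_minimal[rotated])
  show "?R \<subseteq> vec.span ?S"
  proof
    fix v assume "v \<in> ?R"
    then have "v = v $ 3 *s e 3 + v $ 1 *s (e 1 + e 5) + v $ 2 *s (e 2 + e 6)"
      by (simp add: vec_eq_iff forall_6 e_nth)
    also have "\<dots> \<in> vec.span ?S"
      by (intro vec.span_add vec.span_scale vec.span_base) auto
    finally show "v \<in> vec.span ?S" .
  qed
qed

lemma base_point_snd:
  "vec.span {e 4, e 5, e 6} = {v :: 'k::field ^ 6. v $ 1 = 0 \<and> v $ 2 = 0 \<and> v $ 3 = 0}"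
  (is "vec.span ?S = ?R")
proof
  have "vec.subspace ?R" by (auto simp: vec.subspace_def)
  moreover have "?S \<subseteq> ?R" by (auto simp: e_nth)
  ultimately show "vec.span ?S \<subseteq> ?R" by (rule vec.span_minimal[rotated])
  show "?R \<subseteq> vec.span ?S"
  proof
    fix v assume "v \<in> ?R"
    then have "v = v $ 4 *s e 4 + v $ 5 *s e 5 + v $ 6 *s e 6"
      by (simp add: vec_eq_iff forall_6 e_nth)
    also have "\<dots> \<in> vec.span ?S"
      by (intro vec.span_add vec.span_scale vec.span_base) auto
    finally show "v \<in> vec.span ?S" .
  qed
qed

definition base_point :: "('k::field ^ 6) set \<times> ('k ^ 6) set" where
  "base_point = (vec.span {e 3, e 1 + e 5, e 2 + e 6}, vec.span {e 4, e 5, e 6})"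

lemma fst_base_point: "fst base_point = {v :: 'k::field ^ 6. v $ 4 = 0 \<and> v $ 5 = v $ 1 \<and> v $ 6 = v $ 2}"
  unfolding base_point_def base_point_fst by simp

lemma snd_base_point: "snd base_point = {v :: 'k::field ^ 6. v $ 1 = 0 \<and> v $ 2 = 0 \<and> v $ 3 = 0}"
  unfolding base_point_def base_point_snd by simp

lemma lagrangian_base_point:
  "lagrangian (fst base_point :: ('k::field ^ 6) set)" "lagrangian (snd base_point :: ('k ^ 6) set)"
proof -
  \<comment> \<open>The first three columns are the generators of the two base subspaces, so both
    are translates of \<open>flag 3\<close> under \<open>Sp6\<close>.\<close>
  let ?g = "cols6 (vec6 0 0 1 0 0 0) (vec6 1 0 0 0 1 0) (vec6 0 1 0 0 0 1)
    (vec6 0 0 0 0 1 0) (vec6 0 0 0 0 0 1) (vec6 0 0 0 1 0 0) :: 'k ^ 6 ^ 6"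
  let ?h = "cols6 (vec6 0 0 0 1 0 0) (vec6 0 0 0 0 1 0) (vec6 0 0 0 0 0 1)
    (vec6 (-1) 0 0 0 0 0) (vec6 0 (-1) 0 0 0 0) (vec6 0 0 (-1) 0 0 0) :: 'k ^ 6 ^ 6"
  have "?g \<in> Sp6" "?h \<in> Sp6" by (rule cols6_Sp6; simp add: \<omega>_expand)+
  then have L: "lagrangian (act ?g (flag 3))" "lagrangian (act ?h (flag 3))"
    by (auto intro: lagrangian_act lagrangian_flag3)
  have "act ?g (flag 3) = fst base_point"
    unfolding fst_base_point
    by (rule Set.set_eqI) (simp only: act_flag3 forall_6, auto simp: cols6_def)
  moreover have "act ?h (flag 3) = snd base_point"
    unfolding snd_base_point
    by (rule Set.set_eqI) (simp only: act_flag3 forall_6, auto simp: cols6_def)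
  ultimately show "lagrangian (fst base_point :: ('k ^ 6) set)" "lagrangian (snd base_point :: ('k ^ 6) set)"
    using L by simp_all
qed

text \<open>
  In characteristic 2 the condition on \<open>\<xi>\<close> forces \<open>a = \<epsilon>\<^sup>2\<close>; otherwise it can be solved for \<open>\<xi>\<close> with
  any \<open>a\<close>, in particular with \<open>a = 1\<close>.
\<close>

lemma family_in_orbit:
  fixes m \<epsilon> a \<xi> :: "'k::field"
  assumes nz: "m \<noteq> 0" "\<epsilon> \<noteq> 0" "a \<noteq> 0" and \<xi>: "2 * \<xi> * (m * m) * a = a + \<epsilon> * \<epsilon>"
  shows "orbit_map (chart_lift 0 (- \<epsilon>) (\<epsilon> * m) (-1) 0 (m * m), chart_lift a 0 0 0 0 0) \<in> Borel_orbit base_point"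
proof -
  \<comment> \<open>Entries 4 and 5 of the last column are forced by orthogonality to columns 3 and
    2, entry 1 by \<open>t11 = a\<close>. The condition on \<open>\<xi>\<close> is what puts the
    image of \<open>e 2 + e 6\<close> into the first graph.\<close>
  define b where "b = cols6 (vec6 (- m / \<epsilon>) 0 0 0 0 0) (vec6 (m * \<xi> / \<epsilon>) 1 0 0 0 0)
    (vec6 (- 1 / \<epsilon>) (- m) 1 0 0 0) (vec6 0 0 0 1 0 0) (vec6 0 0 0 m 1 0)
    (vec6 (- \<epsilon> / (a * m)) 0 0 (m * \<xi> - 1 / m) \<xi> (- \<epsilon> / m))"
  have b: "b \<in> Sp6" unfolding b_def
    by (rule cols6_Sp6) (use nz in \<open>simp_all add: \<omega>_expand field_simps\<close>)
  have six: "j \<in> {1..6} \<Longrightarrow> j = 1 \<or> j = 2 \<or> j = 3 \<or> j = 4 \<or> j = 5 \<or> j = 6" for j :: nat by auto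
  have "b *v e j \<in> flag j" if "j \<in> {1..6}" for j
    using six[OF that]
    by (elim disjE) (simp_all only: flag_mem matrix_vector_6 e_nth, simp_all add: b_def)
  with b have B: "b \<in> Borel" by (rule Borel_I)
  \<comment> \<open>The condition on \<open>\<xi>\<close> multiplied by
    \<open>\<epsilon> * \<epsilon> * m * z\<close>, in the form reached after clearing denominators
    below.\<close>
  have key: "\<epsilon> * (\<epsilon> * (\<xi> * (a * (m * (m * (m * (2 * z))))))) = \<epsilon> * (\<epsilon> * (a * (m * z))) + \<epsilon> * (\<epsilon> * (\<epsilon> * (\<epsilon> * (m * z))))" for z
  proof -
    have "\<epsilon> * \<epsilon> * m * z * (2 * \<xi> * (m * m) * a) = \<epsilon> * \<epsilon> * m * z * (a + \<epsilon> * \<epsilon>)" unfolding \<xi> ..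
    then show ?thesis by (simp add: algebra_simps)
  qed
  have "act b (fst base_point) \<subseteq> act (chart_lift 0 (- \<epsilon>) (\<epsilon> * m) (-1) 0 (m * m)) (flag 3)"
  proof
    fix v assume "v \<in> act b (fst base_point)"
    then obtain w where w: "v = b *v w" "w $ 4 = 0" "w $ 5 = w $ 1" "w $ 6 = w $ 2"
      by (auto simp: act_def fst_base_point)
    show "v \<in> act (chart_lift 0 (- \<epsilon>) (\<epsilon> * m) (-1) 0 (m * m)) (flag 3)"
      unfolding act_chart_lift w(1) matrix_vector_6 b_def column_cols6 using w(2-) nz \<xi>
      by (simp add: field_simps key)
  qed
  then have V: "act b (fst base_point) = act (chart_lift 0 (- \<epsilon>) (\<epsilon> * m) (-1) 0 (m * m)) (flag 3)"
    by (intro lagrangian_eq lagrangian_act lagrangian_base_point lagrangian_flag3 b chart_lift_Sp6)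
  have "act b (snd base_point) \<subseteq> act (chart_lift a 0 0 0 0 0) (flag 3)"
  proof
    fix v assume "v \<in> act b (snd base_point)"
    then obtain w where w: "v = b *v w" "w $ 1 = 0" "w $ 2 = 0" "w $ 3 = 0"
      by (auto simp: act_def snd_base_point)
    show "v \<in> act (chart_lift a 0 0 0 0 0) (flag 3)"
      unfolding act_chart_lift w(1) matrix_vector_6 b_def column_cols6 using w(2-) nz
      by (simp add: field_simps)
  qed
  then have W: "act b (snd base_point) = act (chart_lift a 0 0 0 0 0) (flag 3)"
    by (intro lagrangian_eq lagrangian_act lagrangian_base_point lagrangian_flag3 b chart_lift_Sp6)
  show ?thesis unfolding Borel_orbit_def orbit_map_flag using V W B by auto
qed

section \<open>Equations satisfied on the orbit\<close>

lemma orbit_point: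
  fixes x :: "('k::field ^ 6) set \<times> ('k ^ 6) set"
  assumes "x \<in> Borel_orbit base_point" "x \<in> charts"
  obtains b V W where "b \<in> Borel" "x = (V, W)" "V = act b (fst base_point)" "W = act b (snd base_point)"
    "lagrangian V" "lagrangian W" "charted V" "charted W"
  using assms by (auto simp: Borel_orbit_def charts_def X_space_def)

text \<open>
  The point \<open>d = b e\<^sub>5\<close> lies in the second subspace, while \<open>d + b e\<^sub>1\<close>, with \<open>b e\<^sub>1\<close> a multiple of
  \<open>e\<^sub>1\<close>, lies in the first. Comparing chart coordinates gives a quadratic equation for
  \<open>(d\<^sub>4, d\<^sub>5)\<close>, which is proportional to \<open>(s13, -s12)\<close>.
\<close>

lemma orbit_quadratic_relation:
  fixes V W :: "('k::field ^ 6) set"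
  assumes b: "b \<in> Borel" and V: "V = act b (fst base_point)" and W: "W = act b (snd base_point)"
    and L: "lagrangian V" "lagrangian W" "charted V" "charted W"
  defines "s12 \<equiv> coord 1 0 0 V $ 3" and "s13 \<equiv> coord 1 0 0 V $ 2" and "s22 \<equiv> coord 0 1 0 V $ 3"
    and "s23 \<equiv> coord 0 1 0 V $ 2" and "s33 \<equiv> coord 0 0 1 V $ 2"
    and "t11 \<equiv> coord 1 0 0 W $ 6" and "t12 \<equiv> coord 1 0 0 W $ 3" and "t13 \<equiv> coord 1 0 0 W $ 2"
    and "t22 \<equiv> coord 0 1 0 W $ 3" and "t23 \<equiv> coord 0 1 0 W $ 2" and "t33 \<equiv> coord 0 0 1 W $ 2"
  shows "(t11 * (t22 - s22) + t12 * t12) * s13 * s13 - 2 * (t11 * (t23 - s23) + t12 * t13) * s12 * s13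
    + (t11 * (t33 - s33) + t13 * t13) * s12 * s12 = 0" (is "?M11 * s13 * s13 - 2 * ?M12 * s12 * s13 + ?M22 * s12 * s12 = 0")
proof -
  define f where "f j = b *v e j" for j
  have pres: "\<omega> (f i) (f j) = \<omega> (e i) (e j)" for i j
    using b by (simp add: f_def Borel_def Sp6_def)
  have fl: "f j \<in> flag j" if "j \<in> {1..6}" for j
    unfolding f_def using b that by (rule Borel_mem_flag)
  have f1: "f 1 $ 2 = 0" "f 1 $ 3 = 0" "f 1 $ 4 = 0" "f 1 $ 5 = 0" "f 1 $ 6 = 0"
    using fl[of 1] unfolding flag_mem by auto
  have f2: "f 2 $ 3 = 0" "f 2 $ 4 = 0" "f 2 $ 5 = 0" "f 2 $ 6 = 0" using fl[of 2] unfolding flag_mem by auto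
  have f3: "f 3 $ 4 = 0" "f 3 $ 5 = 0" "f 3 $ 6 = 0" using fl[of 3] unfolding flag_mem by auto
  have f5: "f 5 $ 6 = 0" using fl[of 5] unfolding flag_mem by auto
  have mem: "f 3 \<in> V" "f 1 + f 5 \<in> V" "f 5 \<in> W"
    unfolding f_def V W fst_base_point snd_base_point act_def
    by (auto simp: e_nth matrix_vector_right_distrib[symmetric] intro!: imageI)
  \<comment> \<open>The vector \<open>f 3\<close> lies in \<open>V\<close> and has zero entries 4,
    5, 6, so \<open>s11\<close> times its first entry is 0; if that entry vanished, so would
    \<open>f 3\<close>.\<close>
  have s11: "coord 1 0 0 V $ 6 = 0"
  proof -
    have "\<omega> (f 3) (f 4) = 1" unfolding pres by (simp add: \<omega>_expand e_nth)
    then have "f 3 \<noteq> 0" by (auto simp: \<omega>_expand)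
    moreover have "f 3 = 0" if "f 3 $ 1 = 0"
      using charted_coords[OF L(1,3) mem(1)] f3 that by (simp add: vec_eq_iff forall_6)
    ultimately have "f 3 $ 1 \<noteq> 0" by blast
    then show ?thesis using charted_coords(1)[OF L(1,3) mem(1)] f3 by simp
  qed
  \<comment> \<open>Only entry 5 of \<open>f 5\<close> contributes to its pairing with
    \<open>f 2\<close>. Its square is cancelled at the end.\<close>
  have d5: "f 5 $ 5 \<noteq> 0"
  proof -
    have "\<omega> (f 2) (f 5) = 1" unfolding pres by (simp add: \<omega>_expand e_nth)
    then show ?thesis using f2 f5 by (auto simp: \<omega>_expand)
  qed
  define d1 d4 d5 \<beta> where "d1 = f 5 $ 1" "d4 = f 5 $ 4" "d5 = f 5 $ 5" "\<beta> = f 1 $ 1"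
  note d = d1_d4_d5_\<beta>_def
  note cV = charted_coords[OF L(1,3) mem(2), folded assms(8-18), unfolded vector_add_component f1 f5 s11, folded d]
  note cW = charted_coords[OF L(2,4) mem(3), folded assms(8-18), unfolded f5, folded d]
  have v1: "s12 * d4 + s13 * d5 = 0" using cV(1) by (simp add: add_eq_0_iff)
  have w1: "t11 * d1 = t12 * d4 + t13 * d5" using cW(1) by (simp add: algebra_simps)
  have e3: "s12 * (\<beta> + d1) + s22 * d4 + s23 * d5 = t12 * d1 + t22 * d4 + t23 * d5"
    using cV(2) cW(2) by simp
  have e2: "s13 * (\<beta> + d1) + s23 * d4 + s33 * d5 = t13 * d1 + t23 * d4 + t33 * d5"
    using cV(3) cW(3) by simp
  \<comment> \<open>Combine \<open>e3\<close> and \<open>e2\<close> with weights \<open>d4\<close>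
    and \<open>d5\<close>: the terms in \<open>s12\<close>, \<open>s13\<close> cancel by
    \<open>v1\<close>, and \<open>w1\<close> turns the remaining term into minus the square of
    \<open>?w\<close>.\<close>
  have Md: "?M11 * d4 * d4 + 2 * ?M12 * d4 * d5 + ?M22 * d5 * d5 = 0"
  proof -
    let ?w = "t12 * d4 + t13 * d5"
    have e3': "(t22 - s22) * d4 + (t23 - s23) * d5 = s12 * (\<beta> + d1) - t12 * d1"
      using e3 by (simp add: algebra_simps)
    have e2': "(t23 - s23) * d4 + (t33 - s33) * d5 = s13 * (\<beta> + d1) - t13 * d1"
      using e2 by (simp add: algebra_simps)
    have "?M11 * d4 * d4 + 2 * ?M12 * d4 * d5 + ?M22 * d5 * d5
        = t11 * (d4 * ((t22 - s22) * d4 + (t23 - s23) * d5) + d5 * ((t23 - s23) * d4 + (t33 - s33) * d5)) + ?w * ?w"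
      by (simp add: algebra_simps)
    also have "\<dots> = t11 * ((\<beta> + d1) * (s12 * d4 + s13 * d5)) - (t11 * d1) * ?w + ?w * ?w"
      unfolding e3' e2' by (simp add: algebra_simps)
    also have "\<dots> = 0" unfolding v1 w1 by simp
    finally show ?thesis .
  qed
  \<comment> \<open>By \<open>v1\<close>, \<open>d5\<close> times \<open>(s13, - s12)\<close> is
    \<open>- s12\<close> times \<open>(d4, d5)\<close>, so the form also vanishes at
    \<open>(s13, - s12)\<close>.\<close>
  have "d5 * d5 * (?M11 * s13 * s13 - 2 * ?M12 * s12 * s13 + ?M22 * s12 * s12) = 0"
  proof -
    have sd: "s13 * d5 = - (s12 * d4)" using v1 by (simp add: add_eq_0_iff)
    have *: "d5 * d5 * (A * s13 * s13 - 2 * B * s12 * s13 + C * s12 * s12)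
        = A * (s13 * d5) * (s13 * d5) - 2 * B * s12 * d5 * (s13 * d5) + C * s12 * s12 * d5 * d5" for A B C
      by (simp add: algebra_simps)
    have "d5 * d5 * (A * s13 * s13 - 2 * B * s12 * s13 + C * s12 * s12)
        = s12 * s12 * (A * d4 * d4 + 2 * B * d4 * d5 + C * d5 * d5)" for A B C
      unfolding * sd by (simp add: algebra_simps)
    from this[of ?M11 ?M12 ?M22] show ?thesis unfolding Md mult_zero_right .
  qed
  then show ?thesis using d5 unfolding d by simp
qed

text \<open>
  In characteristic 2 the quadratic form \<open>q\<close> polarises to \<open>\<omega>\<close>, and \<open>q \<circ> b\<inverse> - q\<close> is additive, hence a
  combination of squares of coordinates. As \<open>q\<close> vanishes on the base point, both subspaces are
  totally singular for \<open>q \<circ> b\<inverse>\<close>.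
\<close>

lemma orbit_char_2_relation:
  fixes V W :: "('k::field ^ 6) set"
  assumes two: "(2 :: 'k) = 0"
    and b: "b \<in> Borel" and V: "V = act b (fst base_point)" and W: "W = act b (snd base_point)"
  shows "\<exists>c4 c5 c6. \<forall>v\<in>V \<union> W. v $ 1 * v $ 6 + v $ 2 * v $ 5 + v $ 3 * v $ 4
    = c4 * (v $ 4 * v $ 4) + c5 * (v $ 5 * v $ 5) + c6 * (v $ 6 * v $ 6)"
proof -
  define q where "q v = v $ 1 * v $ 6 + v $ 2 * v $ 5 + v $ 3 * v $ 4" for v :: "'k ^ 6"
  have dbl: "x + x = 0" for x :: 'k using two by (metis mult_2 mult_zero_left)
  have neg: "- x = x" for x :: 'k using dbl[of x] by (simp add: eq_neg_iff_add_eq_0)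
  have q_add: "q (v + w) = q v + q w + \<omega> v w" for v w
    unfolding q_def \<omega>_expand diff_conv_add_uminus neg by (simp add: algebra_simps)
  have q_scale: "q (c *s v) = c * c * q v" for c v
    unfolding q_def by (simp add: algebra_simps)
  define f where "f j = b *v e j" for j
  have pres: "\<omega> (b *v v) (b *v w) = \<omega> v w" for v w using b by (simp add: Borel_def Sp6_def)
  have fl: "f j \<in> flag j" if "j \<in> {1..6}" for j
    unfolding f_def using b that by (rule Borel_mem_flag)
  have f1: "f 1 $ 2 = 0" "f 1 $ 3 = 0" "f 1 $ 4 = 0" "f 1 $ 5 = 0" "f 1 $ 6 = 0"
    using fl[of 1] unfolding flag_mem by auto
  have f2: "f 2 $ 3 = 0" "f 2 $ 4 = 0" "f 2 $ 5 = 0" "f 2 $ 6 = 0" using fl[of 2] unfolding flag_mem by auto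
  have f3: "f 3 $ 4 = 0" "f 3 $ 5 = 0" "f 3 $ 6 = 0" using fl[of 3] unfolding flag_mem by auto
  have qf: "q (f 1) = 0" "q (f 2) = 0" "q (f 3) = 0" using f1 f2 f3 by (simp_all add: q_def)
  \<comment> \<open>Since \<open>q\<close> vanishes on \<open>f 1\<close>, \<open>f 2\<close>,
    \<open>f 3\<close>, only three square terms survive, and the mixed terms add up to
    \<open>q w\<close> because \<open>b\<close> preserves \<open>\<omega>\<close>.\<close>
  have q_b: "q (b *v w) = q w + w $ 4 * w $ 4 * q (f 4) + w $ 5 * w $ 5 * q (f 5) + w $ 6 * w $ 6 * q (f 6)" for w
  proof -
    have "b *v w = w $ 1 *s f 1 + w $ 2 *s f 2 + w $ 3 *s f 3 + w $ 4 *s f 4 + w $ 5 *s f 5 + w $ 6 *s f 6"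
      unfolding f_def matrix_vector_6 by (simp add: vec_eq_iff e_nth)
    moreover have "\<omega> (f i) (f j) = \<omega> (e i) (e j)" for i j unfolding f_def by (rule pres)
    ultimately show ?thesis
      by (simp add: q_add q_scale \<omega>_add \<omega>_scale qf del: One_nat_def)
        (simp add: \<omega>_expand e_nth q_def algebra_simps del: One_nat_def)
  qed
  define A where "A = (\<lambda>v. \<omega> (f 1) v * \<omega> (f 1) v * q (f 6) + \<omega> (f 2) v * \<omega> (f 2) v * q (f 5) + \<omega> (f 3) v * \<omega> (f 3) v * q (f 4))"
  have qA: "q v = A v" if v: "v \<in> V \<union> W" for v
  proof -
    \<comment> \<open>On the first base subspace \<open>q\<close> has the form
      \<open>x y + y x\<close>, which is 0 in characteristic 2; on the second every product has a
      zero factor.\<close>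
    obtain w where w: "v = b *v w" "q w = 0"
      using v unfolding V W fst_base_point snd_base_point act_def q_def
      by (auto simp: neg mult.commute dbl)
    have "\<omega> (f 1) v = w $ 6" "\<omega> (f 2) v = w $ 5" "\<omega> (f 3) v = w $ 4"
      unfolding f_def w(1) pres by (simp_all add: \<omega>_expand e_nth)
    then show ?thesis unfolding A_def w(1) q_b using w by (simp add: algebra_simps)
  qed
  have sq: "(x + y) * (x + y) = x * x + y * y" for x y :: 'k
    using dbl[of "x * y"] by (simp add: algebra_simps)
  \<comment> \<open>The vectors \<open>f 1\<close>, \<open>f 2\<close>, \<open>f 3\<close> pair only
    with entries 4, 5, 6, and squaring is additive, so no mixed products occur.\<close>
  have "\<exists>c4 c5 c6. \<forall>v. A v = c4 * (v $ 4 * v $ 4) + c5 * (v $ 5 * v $ 5) + c6 * (v $ 6 * v $ 6)"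
  proof (intro exI allI)
    fix v
    have "\<omega> (f 1) v = f 1 $ 1 * v $ 6" "\<omega> (f 2) v = f 2 $ 1 * v $ 6 + f 2 $ 2 * v $ 5"
      "\<omega> (f 3) v = f 3 $ 1 * v $ 6 + f 3 $ 2 * v $ 5 + f 3 $ 3 * v $ 4"
      using f1 f2 f3 by (simp_all add: \<omega>_expand)
    then show "A v = (f 3 $ 3 * f 3 $ 3 * q (f 4)) * (v $ 4 * v $ 4)
      + (f 2 $ 2 * f 2 $ 2 * q (f 5) + f 3 $ 2 * f 3 $ 2 * q (f 4)) * (v $ 5 * v $ 5)
      + (f 1 $ 1 * f 1 $ 1 * q (f 6) + f 2 $ 1 * f 2 $ 1 * q (f 5) + f 3 $ 1 * f 3 $ 1 * q (f 4)) * (v $ 6 * v $ 6)"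
      unfolding A_def by (simp only: sq) (simp add: algebra_simps)
  qed
  then show ?thesis using qA unfolding q_def by fastforce
qed

theorem proposition5p1:
  fixes x :: "('k::alg_closed_field ^ 6) set \<times> ('k ^ 6) set"
  assumes "x = (vec.span {e 3, e 1 + e 5, e 2 + e 6}, vec.span {e 4, e 5, e 6})"
  shows "\<not> normal_in_X (X_topology closure_of Borel_orbit x)"
proof -
  interpret X: space_with_functions X_topology "X_regular :: _ \<Rightarrow> (_ \<Rightarrow> 'k) \<Rightarrow> bool"
    by (rule X_regular_space)
  note reg = X.reg_add X.reg_mult X.reg_diff X.reg_const[OF X.reg_openin] X_regular_coord
  have x: "x = base_point" using assms by (simp add: base_point_def)
  \<comment> \<open>Along \<open>?\<gamma>\<close> only \<open>s33\<close> varies. The curves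
    \<open>?\<delta>\<close> are the points of \<open>family_in_orbit\<close> with
    \<open>\<epsilon> = s\<close>; at \<open>s = 0\<close> they meet \<open>?\<gamma>\<close> at
    parameter \<open>m * m\<close> if \<open>a 0\<close> agrees with the constant chosen in
    \<open>?\<gamma>\<close>.\<close>
  let ?\<gamma> = "\<lambda>a s :: 'k. (chart_lift 0 0 0 (-1) 0 s, chart_lift a 0 0 0 0 0)"
  let ?\<delta> = "\<lambda>a m s :: 'k. (chart_lift 0 (- s) (s * m) (-1) 0 (m * m), chart_lift (a s) 0 0 0 0 0)"
  have \<gamma>: "polynomial_curve entries (?\<gamma> a)" for a
    using polynomial_curve_chart_lift[of 0 0 0 "-1" 0 "[:0, 1:]" "[:a:]" 0 0 0 0 0] by simp
  have \<delta>: "polynomial_curve entries (?\<delta> (poly P) m)" for P m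
    using polynomial_curve_chart_lift[of 0 "[:0, -1:]" "[:0, m:]" "-1" 0 "[:m * m:]" P 0 0 0 0 0]
    by (simp add: mult.commute)
  show ?thesis
  proof (cases "(2 :: 'k) = 0")
    case False
    let ?s12 = "\<lambda>x :: ('k ^ 6) set \<times> ('k ^ 6) set. coord 1 0 0 (fst x) $ 3"
    let ?s13 = "\<lambda>x :: ('k ^ 6) set \<times> ('k ^ 6) set. coord 1 0 0 (fst x) $ 2"
    let ?t11 = "\<lambda>x :: ('k ^ 6) set \<times> ('k ^ 6) set. coord 1 0 0 (snd x) $ 6"
    let ?t12 = "\<lambda>x :: ('k ^ 6) set \<times> ('k ^ 6) set. coord 1 0 0 (snd x) $ 3"
    let ?t13 = "\<lambda>x :: ('k ^ 6) set \<times> ('k ^ 6) set. coord 1 0 0 (snd x) $ 2"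
    let ?M11 = "\<lambda>x. ?t11 x * (coord 0 1 0 (snd x) $ 3 - coord 0 1 0 (fst x) $ 3) + ?t12 x * ?t12 x"
    let ?M12 = "\<lambda>x. ?t11 x * (coord 0 1 0 (snd x) $ 2 - coord 0 1 0 (fst x) $ 2) + ?t12 x * ?t13 x"
    let ?M22 = "\<lambda>x. ?t11 x * (coord 0 0 1 (snd x) $ 2 - coord 0 0 1 (fst x) $ 2) + ?t13 x * ?t13 x"
    show ?thesis unfolding x
    \<comment> \<open>Multiplying the quadratic relation by \<open>M11\<close> and completing the
      square gives \<open>p^2 = q^2 r\<close>. Along \<open>?\<gamma> 1\<close> one has
      \<open>M11 = 1\<close>, \<open>M12 = 0\<close>, \<open>M22 = - s\<close>, so
      \<open>r = s\<close>.\<close>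
    proof (rule not_normal_criterion[where U = charts and \<gamma> = "?\<gamma> 1" and \<delta> = "?\<delta> (poly [:1:])"
          and q = ?s12 and p = "\<lambda>x. ?M11 x * ?s13 x - ?M12 x * ?s12 x"
          and r = "\<lambda>x. ?M12 x * ?M12 x - ?M11 x * ?M22 x"])
      show "X_regular charts ?s12"
        "X_regular charts (\<lambda>x. ?M11 x * ?s13 x - ?M12 x * ?s12 x)"
        "X_regular charts (\<lambda>x. ?M12 x * ?M12 x - ?M11 x * ?M22 x)"
        by (intro reg)+
      fix m s :: 'k assume nz: "m \<noteq> 0" "s \<noteq> 0"
      let ?\<xi> = "(1 + s * s) / (2 * (m * m))"
      have "2 * ?\<xi> * (m * m) * 1 = 1 + s * s" using nz False by (simp add: field_simps)
      then show "orbit_map (?\<delta> (poly [:1:]) m s) \<in> Borel_orbit base_point"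
        using family_in_orbit[of m s 1 ?\<xi>] nz by simp
      show "?s12 (orbit_map (?\<delta> (poly [:1:]) m s)) \<noteq> 0"
        using nz by (simp add: orbit_map_flag coord_chart_lift)
    next
      fix x :: "('k ^ 6) set \<times> ('k ^ 6) set" assume "x \<in> Borel_orbit base_point" "x \<in> charts"
      then obtain b where "b \<in> Borel" "fst x = act b (fst base_point)" "snd x = act b (snd base_point)"
        "lagrangian (fst x)" "lagrangian (snd x)" "charted (fst x)" "charted (snd x)"
        by (rule orbit_point) auto
      note rel = orbit_quadratic_relation[OF this]
      show "(?M11 x * ?s13 x - ?M12 x * ?s12 x) * (?M11 x * ?s13 x - ?M12 x * ?s12 x)
          = ?s12 x * ?s12 x * (?M12 x * ?M12 x - ?M11 x * ?M22 x)"
      proof -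
        have *: "(a * t - b * s) * (a * t - b * s) = s * s * (b * b - a * c)"
          if "a * t * t - 2 * b * s * t + c * s * s = 0" for a b c s t :: 'k
        proof -
          have "(a * t - b * s) * (a * t - b * s) - s * s * (b * b - a * c)
              = a * (a * t * t - 2 * b * s * t + c * s * s)" by (simp add: algebra_simps)
          then show ?thesis unfolding that by simp
        qed
        show ?thesis by (rule *[OF rel])
      qed
    qed (use \<gamma>[of 1] \<delta>[of _ "[:1:]"] in \<open>simp_all add: chart_lift_Sp6 orbit_map_chart_lift[unfolded orbit_map_flag fst_conv snd_conv] orbit_map_flag coord_chart_lift\<close>)
  next
    case True
    let ?s12 = "\<lambda>x :: ('k ^ 6) set \<times> ('k ^ 6) set. coord 1 0 0 (fst x) $ 3 + coord 1 0 0 (snd x) $ 3"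
    let ?s13 = "\<lambda>x :: ('k ^ 6) set \<times> ('k ^ 6) set. coord 1 0 0 (fst x) $ 2 + coord 1 0 0 (snd x) $ 2"
    let ?s22 = "\<lambda>x :: ('k ^ 6) set \<times> ('k ^ 6) set. coord 0 1 0 (fst x) $ 3 + coord 0 1 0 (snd x) $ 3"
    let ?s33 = "\<lambda>x :: ('k ^ 6) set \<times> ('k ^ 6) set. coord 0 0 1 (fst x) $ 2 + coord 0 0 1 (snd x) $ 2"
    have dbl: "x + x = 0" for x :: 'k using True by (metis mult_2 mult_zero_left)
    have neg: "- x = x" for x :: 'k using dbl[of x] by (simp add: eq_neg_iff_add_eq_0)
    have sq: "(x + y) * (x + y) = x * x + y * y" for x y :: 'k
      using dbl[of "x * y"] by (simp add: algebra_simps)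
    show ?thesis unfolding x
    \<comment> \<open>The choice \<open>a = s * s\<close> meets the condition of
      \<open>family_in_orbit\<close> with \<open>\<xi> = 0\<close>. Along \<open>?\<gamma> 0\<close>
      the factors of \<open>r\<close> are \<open>-1\<close> and \<open>s\<close>, with product
      \<open>s\<close> in characteristic 2.\<close>
    proof (rule not_normal_criterion[where U = charts and \<gamma> = "?\<gamma> 0" and \<delta> = "?\<delta> (poly [:0, 0, 1:])"
          and q = ?s12 and p = "\<lambda>x. ?s22 x * ?s13 x" and r = "\<lambda>x. ?s22 x * ?s33 x"])
      show "X_regular charts ?s12" "X_regular charts (\<lambda>x. ?s22 x * ?s13 x)"
        "X_regular charts (\<lambda>x. ?s22 x * ?s33 x)"
        by (intro reg)+
      fix m s :: 'k assume nz: "m \<noteq> 0" "s \<noteq> 0"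
      then show "orbit_map (?\<delta> (poly [:0, 0, 1:]) m s) \<in> Borel_orbit base_point"
        using family_in_orbit[of m s "s * s" 0] dbl by simp
      show "?s12 (orbit_map (?\<delta> (poly [:0, 0, 1:]) m s)) \<noteq> 0"
        using nz by (simp add: orbit_map_flag coord_chart_lift)
    next
      fix x :: "('k ^ 6) set \<times> ('k ^ 6) set" assume "x \<in> Borel_orbit base_point" "x \<in> charts"
      then obtain b where b: "b \<in> Borel" "fst x = act b (fst base_point)" "snd x = act b (snd base_point)"
        and L: "lagrangian (fst x)" "lagrangian (snd x)" and C: "charted (fst x)" "charted (snd x)"
        by (rule orbit_point) auto
      obtain c4 c5 c6 where c: "\<And>v. v \<in> fst x \<union> snd x \<Longrightarrow> v $ 1 * v $ 6 + v $ 2 * v $ 5 + v $ 3 * v $ 4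
          = c4 * (v $ 4 * v $ 4) + c5 * (v $ 5 * v $ 5) + c6 * (v $ 6 * v $ 6)"
        using orbit_char_2_relation[OF True b] by blast
      \<comment> \<open>The relation is evaluated at the second and third chart vectors, whose
        entries 6 are \<open>- s12\<close> and \<open>- s13\<close> by the symmetry of the
        coordinates.\<close>
      have *: "coord 0 1 0 V $ 3 = c4 + c6 * (coord 1 0 0 V $ 3 * coord 1 0 0 V $ 3)"
        "coord 0 0 1 V $ 2 = c5 + c6 * (coord 1 0 0 V $ 2 * coord 1 0 0 V $ 2)"
        if V: "V = fst x \<or> V = snd x" for V
      proof -
        have V': "lagrangian V" "charted V" using V L C by auto
        have "coord a b c V \<in> fst x \<union> snd x" for a b c using V coord_mem(1)[OF V'] by auto
        note q = c[OF this]
        note six = charted_coords(1)[OF V' coord_mem(1)[OF V']]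
        show "coord 0 1 0 V $ 3 = c4 + c6 * (coord 1 0 0 V $ 3 * coord 1 0 0 V $ 3)"
          using q[of 0 1 0] six[of 0 1 0] by (simp add: coord_mem[OF V'])
        show "coord 0 0 1 V $ 2 = c5 + c6 * (coord 1 0 0 V $ 2 * coord 1 0 0 V $ 2)"
          using q[of 0 0 1] six[of 0 0 1] by (simp add: coord_mem[OF V'])
      qed
      \<comment> \<open>Adding the equations of the two subspaces cancels \<open>c4\<close> and
        \<open>c5\<close>, and the squares combine into the square of a sum.\<close>
      have s: "?s22 x = c6 * (?s12 x * ?s12 x)" "?s33 x = c6 * (?s13 x * ?s13 x)"
        using *[of "fst x"] *[of "snd x"] dbl[of c4] dbl[of c5] unfolding sq by (simp_all add: algebra_simps)
      show "?s22 x * ?s13 x * (?s22 x * ?s13 x) = ?s12 x * ?s12 x * (?s22 x * ?s33 x)"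
        unfolding s by (simp only: ac_simps)
    qed (use \<gamma>[of 0] \<delta>[of _ "[:0, 0, 1:]"] in \<open>simp_all add: chart_lift_Sp6 orbit_map_chart_lift[unfolded orbit_map_flag fst_conv snd_conv] orbit_map_flag coord_chart_lift neg\<close>)
  qed
qed

end
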